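(* Let $\Delta$ be an affine building of type A with dimension $n-1$, let $\ell$ be a natural coloring of $\Delta$, and let $\mathcal{L}(\Delta)$ be the associated poset on $\Delta^0 \times \mathbf{Z}$. Then $\mathcal{L}(\Delta)$ is a uniform modular lattice, and $\Delta$ is equal to $\mathcal{C}(\mathcal{L}(\Delta))$, where a vertex $x\in\Delta^0$ is identified with the class $\{(x,k) \mid k \in \mathbf{Z}\}$ in $\mathcal{L}(\Delta)/{\sim}$.
   Context: Affine buildings of type A. A simplicial complex on a nonempty set $V$ is a family of subsets (simplices) of $V$ closed under taking subsets and containing all singletons; its vertex set is denoted by $\Delta^0$; the dimension of a simplex $A$ is $|A|-1$. Isomorphisms are bijections of vertex sets preserving simplices in both directions. The affine Coxeter complex of type A (of dimension $n-1$) is the simplicial complex on $\mathbf{Z}^n/\mathbf{R}\mathbf{1}$ ($\mathbf{1}$ the all-one vector) whose maximal simplices are $\{z, z+e_{\sigma(1)}, \ldots, z+e_{\sigma(1)}+\cdots+e_{\sigma(n-1)}\}$ modulo $\mathbf{R}\mathbf{1}$, for $z \in \mathbf{Z}^n$ and permutations $\sigma$ of $\{1,\ldots,n\}$. An affine building of type A is a simplicial complex $\Delta$ having a family of subcomplexes, called apartments, such that: (B1) each apartment is isomorphic to the affine Coxeter complex of type A; (B2) for any $A,B \in \Delta$ there is an apartment containing $A,B$; (B3) if two apartments $\Sigma,\Sigma'$ contain simplices $A,B$, then there is an isomorphism $\Sigma \to \Sigma'$ fixing $A$ and $B$ pointwise. Natural coloring. Let $\Lambda := \{x \in \mathbf{Z}^n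 \mid 0 \le \sum_{i=1}^n x_i \le n-1\}$, ordered componentwise, and let $\mathcal{O}'(\Lambda)$ be the simplicial complex on $\Lambda$ consisting of the chains $x_0<x_1<\cdots<x_m$ with $x_m<x_0+\mathbf{1}$ (here $<$ means $\le$ componentwise and $\ne$). It is isomorphic to the affine Coxeter complex of type A. A coloring of $\Delta$ is a map $\ell:\Delta^0 \to \{0,1,\ldots,n-1\}$ such that distinct vertices of any simplex have distinct colors. It is natural if for every apartment $\Sigma$ there is an isomorphism $\varrho:\Sigma\to\mathcal{O}'(\Lambda)$ with $\ell(x)=\sum_{i=1}^n \varrho(x)_i$ for all $x\in\Sigma^0$. (Every affine building of type A admits a natural coloring.) The poset $\mathcal{L}(\Delta)$. Fix a natural coloring $\ell$. Let $G(\Delta)$ be the directed graph on $\Delta^0\times\mathbf{Z}$ in which, for distinct $(x,k)$, $(x',k')$, there is an edge from $(x',k')$ to $(x,k)$ iff $x$ and $x'$ belong to a common simplex of $\Delta$ and $\ell(x')+k'n=\ell(x)+kn+1$. Define $(x,k)\preceq(x',k')$ if there is a directed path in $G(\Delta)$ from $(x',k')$ to $(x,k)$; this is a partial order, and the resulting poset is $\mathcal{L}(\Delta)$. Uniform modular lattices. Every lattice is required to satisfy that every interval $[x,y]$ has finite rank (maximum length of a chain, where length is cardinality minus one). A lattice is modular if $(y\wedge z)\vee x=(x\vee z)\wedge y$ whenever $x\preceq y$. An element $y$ covers $x$ if $x\prec y$ and $[x,y]=\{x,y\}$. The ascending operator is $(x)^+:=\bigvee\{y \mid y\text{ covers }x\}$.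 A modular lattice $\mathcal{L}$ is uniform if $(x)^+$ exists for all $x$ and $x\mapsto (x)^+$ is a lattice automorphism. For such $\mathcal{L}$, $(\cdot)^{+k}$ ($k\in\mathbf{Z}$) is the $k$-th power of this automorphism, $x\sim y$ means $(x)^{+k}=y$ for some $k\in\mathbf{Z}$, a chain $x^0\prec\cdots\prec x^m$ is short if $x^m\preceq(x^0)^+$, and $\mathcal{C}(\mathcal{L})$ is the simplicial complex on $\mathcal{L}/{\sim}$ whose simplices are the images modulo $\sim$ of short chains. *)

theory Defs
  imports Complex_Main "HOL-Algebra.Lattice" "HOL-Combinatorics.Permutations"
begin

section \<open>Simplicial complexes\<close>

definition simplicial_complex_on :: "'v set \<Rightarrow> 'v set set \<Rightarrow> bool" where
  "simplicial_complex_on V K \<longleftrightarrow>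
     V \<noteq> {} \<and> K \<subseteq> Pow V \<and> (\<forall>A\<in>K. \<forall>B. B \<subseteq> A \<longrightarrow> B \<in> K) \<and> (\<forall>v\<in>V. {v} \<in> K)"

text \<open>A complex contains all singletons, so its vertex set is the union of its simplices.
  Complexes are therefore represented by their families of simplices alone. The empty set is a
  simplex of every complex.\<close>

definition vertices :: "'v set set \<Rightarrow> 'v set" where
  "vertices K = \<Union>K"

definition simplicial_complex :: "'v set set \<Rightarrow> bool" where
  "simplicial_complex K \<longleftrightarrow> simplicial_complex_on (vertices K) K"

definition subcomplex :: "'v set set \<Rightarrow> 'v set set \<Rightarrow> bool" where
  "subcomplex S K \<longleftrightarrow> simplicial_complex S \<and> S \<subseteq> K"

definition complex_iso :: "('v \<Rightarrow> 'w) \<Rightarrow> 'v set set \<Rightarrow> 'w set set \<Rightarrow> bool" where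
  "complex_iso f K K' \<longleftrightarrow>
     bij_betw f (vertices K) (vertices K') \<and>
     (\<forall>A. A \<subseteq> vertices K \<longrightarrow> (A \<in> K \<longleftrightarrow> f ` A \<in> K'))"


section \<open>The affine Coxeter complex of type A\<close>

text \<open>Vectors in \<open>\<int>\<^sup>n\<close> are functions on \<open>nat\<close> vanishing outside \<open>{1..n}\<close>. On such functions the
  library order on functions is the componentwise order, and its strict part is \<open>\<le>\<close> and \<open>\<noteq>\<close>.\<close>

type_synonym zvec = "nat \<Rightarrow> int"

definition Zn :: "nat \<Rightarrow> zvec set" where
  "Zn n = {z. \<forall>i. i \<notin> {1..n} \<longrightarrow> z i = 0}"

definition unit_vec :: "nat \<Rightarrow> zvec" where
  "unit_vec i = (\<lambda>j. if j = i then 1 else 0)"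

definition ones :: "nat \<Rightarrow> zvec" where
  "ones n = (\<lambda>j. if j \<in> {1..n} then 1 else 0)"

text \<open>Congruence modulo \<open>\<real>\<one>\<close>.\<close>

definition mod_ones :: "nat \<Rightarrow> (zvec \<times> zvec) set" where
  "mod_ones n = {(z, w). z \<in> Zn n \<and> w \<in> Zn n \<and>
     (\<exists>c::real. \<forall>i\<in>{1..n}. real_of_int (z i) - real_of_int (w i) = c)}"

definition coxeter_complex :: "nat \<Rightarrow> zvec set set set" where
  "coxeter_complex n =
     {A. \<exists>z\<in>Zn n. \<exists>\<sigma>. \<sigma> permutes {1..n} \<and>
        A \<subseteq> (\<lambda>k. mod_ones n `` {\<lambda>i. z i + (\<Sum>j=1..k. unit_vec (\<sigma> j) i)}) ` {0..<n}}"

definition Lambda :: "nat \<Rightarrow> zvec set" where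
  "Lambda n = {x \<in> Zn n. 0 \<le> (\<Sum>i=1..n. x i) \<and> (\<Sum>i=1..n. x i) \<le> int n - 1}"

text \<open>A chain is given by the list of its elements in increasing order; the empty list yields
  the empty simplex.\<close>

definition O_Lambda :: "nat \<Rightarrow> zvec set set" where
  "O_Lambda n = {set xs | xs. set xs \<subseteq> Lambda n \<and> sorted_wrt (<) xs \<and>
     (xs \<noteq> [] \<longrightarrow> last xs < (\<lambda>i. hd xs i + ones n i))}"


section \<open>Affine buildings of type A\<close>

text \<open>The family \<open>\<A>\<close> of apartments is part of the data, since natural colorings refer to it.\<close>

definition affine_building :: "nat \<Rightarrow> 'v set set \<Rightarrow> 'v set set set \<Rightarrow> bool" where
  "affine_building n \<Delta> \<A> \<longleftrightarrow>
     simplicial_complex \<Delta> \<and>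
     (\<forall>\<Sigma>\<in>\<A>. subcomplex \<Sigma> \<Delta>) \<and>
     (\<forall>\<Sigma>\<in>\<A>. \<exists>f. complex_iso f \<Sigma> (coxeter_complex n)) \<and>
     (\<forall>A\<in>\<Delta>. \<forall>B\<in>\<Delta>. \<exists>\<Sigma>\<in>\<A>. A \<in> \<Sigma> \<and> B \<in> \<Sigma>) \<and>
     (\<forall>\<Sigma>\<in>\<A>. \<forall>\<Sigma>'\<in>\<A>. \<forall>A B. A \<in> \<Sigma> \<and> B \<in> \<Sigma> \<and> A \<in> \<Sigma>' \<and> B \<in> \<Sigma>' \<longrightarrow>
        (\<exists>f. complex_iso f \<Sigma> \<Sigma>' \<and> (\<forall>x\<in>A \<union> B. f x = x)))"

definition coloring :: "nat \<Rightarrow> 'v set set \<Rightarrow> ('v \<Rightarrow> nat) \<Rightarrow> bool" where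
  "coloring n \<Delta> col \<longleftrightarrow> col \<in> vertices \<Delta> \<rightarrow> {0..<n} \<and> (\<forall>A\<in>\<Delta>. inj_on col A)"

definition natural_coloring ::
  "nat \<Rightarrow> 'v set set \<Rightarrow> 'v set set set \<Rightarrow> ('v \<Rightarrow> nat) \<Rightarrow> bool" where
  "natural_coloring n \<Delta> \<A> col \<longleftrightarrow> coloring n \<Delta> col \<and>
     (\<forall>\<Sigma>\<in>\<A>. \<exists>\<rho>. complex_iso \<rho> \<Sigma> (O_Lambda n) \<and>
        (\<forall>x\<in>vertices \<Sigma>. int (col x) = (\<Sum>i=1..n. \<rho> x i)))"


section \<open>The poset of a building\<close>

text \<open>A pair \<open>((x', k'), (x, k))\<close> is an edge from \<open>(x', k')\<close> to \<open>(x, k)\<close>.\<close>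

definition building_edges ::
  "nat \<Rightarrow> 'v set set \<Rightarrow> ('v \<Rightarrow> nat) \<Rightarrow> (('v \<times> int) \<times> ('v \<times> int)) set" where
  "building_edges n \<Delta> col = {((x', k'), (x, k)).
     x' \<in> vertices \<Delta> \<and> x \<in> vertices \<Delta> \<and> (x', k') \<noteq> (x, k) \<and>
     (\<exists>A\<in>\<Delta>. x \<in> A \<and> x' \<in> A) \<and>
     int (col x') + k' * int n = int (col x) + k * int n + 1}"

definition building_poset ::
  "nat \<Rightarrow> 'v set set \<Rightarrow> ('v \<Rightarrow> nat) \<Rightarrow> ('v \<times> int) gorder" where
  "building_poset n \<Delta> col =
     \<lparr>carrier = vertices \<Delta> \<times> UNIV, eq = (=),
      le = (\<lambda>p q. (q, p) \<in> (building_edges n \<Delta> col)\<^sup>*)\<rparr>"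


section \<open>Uniform modular lattices\<close>

definition intervals_finite_rank :: "('a, 'b) gorder_scheme \<Rightarrow> bool" where
  "intervals_finite_rank L \<longleftrightarrow>
     (\<forall>x\<in>carrier L. \<forall>y\<in>carrier L. x \<sqsubseteq>\<^bsub>L\<^esub> y \<longrightarrow>
        (\<exists>r. \<forall>C. C \<subseteq> \<lbrace>x..y\<rbrace>\<^bsub>L\<^esub> \<and> Complete_Partial_Order.chain (le L) C \<longrightarrow>
           finite C \<and> card C \<le> r + 1))"

definition modular_lattice :: "('a, 'b) gorder_scheme \<Rightarrow> bool" where
  "modular_lattice L \<longleftrightarrow> lattice L \<and> intervals_finite_rank L \<and>
     (\<forall>x\<in>carrier L. \<forall>y\<in>carrier L. \<forall>z\<in>carrier L. x \<sqsubseteq>\<^bsub>L\<^esub> y \<longrightarrow>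
        (y \<sqinter>\<^bsub>L\<^esub> z) \<squnion>\<^bsub>L\<^esub> x = (x \<squnion>\<^bsub>L\<^esub> z) \<sqinter>\<^bsub>L\<^esub> y)"

definition covers :: "('a, 'b) gorder_scheme \<Rightarrow> 'a \<Rightarrow> 'a \<Rightarrow> bool" where
  "covers L y x \<longleftrightarrow> x \<in> carrier L \<and> y \<in> carrier L \<and> x \<sqsubset>\<^bsub>L\<^esub> y \<and> \<lbrace>x..y\<rbrace>\<^bsub>L\<^esub> = {x, y}"

definition asc :: "('a, 'b) gorder_scheme \<Rightarrow> 'a \<Rightarrow> 'a" where
  "asc L x = \<Squnion>\<^bsub>L\<^esub> {y. covers L y x}"

definition lattice_automorphism :: "('a, 'b) gorder_scheme \<Rightarrow> ('a \<Rightarrow> 'a) \<Rightarrow> bool" where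
  "lattice_automorphism L f \<longleftrightarrow>
     bij_betw f (carrier L) (carrier L) \<and> join_pres L L f \<and> meet_pres L L f"

definition uniform_modular_lattice :: "('a, 'b) gorder_scheme \<Rightarrow> bool" where
  "uniform_modular_lattice L \<longleftrightarrow> modular_lattice L \<and>
     (\<forall>x\<in>carrier L. \<exists>s. is_lub L s {y. covers L y x}) \<and>
     lattice_automorphism L (asc L)"

definition asc_pow :: "('a, 'b) gorder_scheme \<Rightarrow> int \<Rightarrow> 'a \<Rightarrow> 'a" where
  "asc_pow L k = (if 0 \<le> k then asc L ^^ nat k
                  else inv_into (carrier L) (asc L) ^^ nat (- k))"

definition asc_equiv :: "('a, 'b) gorder_scheme \<Rightarrow> ('a \<times> 'a) set" where
  "asc_equiv L = {(x, y). x \<in> carrier L \<and> y \<in> carrier L \<and> (\<exists>k::int. asc_pow L k x = y)}"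

text \<open>As above, the empty list is allowed, so that the empty simplex belongs to the complex.\<close>

definition short_chain :: "('a, 'b) gorder_scheme \<Rightarrow> 'a list \<Rightarrow> bool" where
  "short_chain L xs \<longleftrightarrow> set xs \<subseteq> carrier L \<and> sorted_wrt (lless L) xs \<and>
     (xs \<noteq> [] \<longrightarrow> last xs \<sqsubseteq>\<^bsub>L\<^esub> asc L (hd xs))"

definition lattice_complex :: "('a, 'b) gorder_scheme \<Rightarrow> 'a set set set" where
  "lattice_complex L = {(\<lambda>x. asc_equiv L `` {x}) ` set xs | xs. short_chain L xs}"

end

theory Submission
  imports Defs
begin

text \<open>
  The elements \<open>(x, k)\<close> of the poset over one apartment form a copy of \<open>\<int>\<^sup>n\<close>: a natural coloring
  identifies the vertices of the apartment with the vectors of coordinate sum between \<open>0\<close> and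
  \<open>n - 1\<close>, and \<open>(x, k)\<close> is placed at the vector of \<open>x\<close> plus \<open>k\<close> times the all-one vector
  (\<open>pos\<close>). Covering pairs become the steps \<open>z \<mapsto> z + e\<^sub>i\<close> (\<open>chart_up_iff\<close>), so over a single
  apartment the poset is the lattice \<open>\<int>\<^sup>n\<close> with componentwise maximum and minimum. The theorem
  follows once these local pictures are compatible with the order of the whole building.

  Compatibility comes from retractions onto an apartment. The axioms only provide isomorphisms of
  apartments as uncolored complexes, so the first point is that an isomorphism fixing a chamber
  preserves colors. It does, because any two vertices of equal color in an apartment have images
  of equal color: exchanging one vertex of a chamber for its only alternative keeps the color of
  the image, and such exchanges connect all vectors of equal coordinate sum
  (\<open>iso_colour\<close>). Hence coordinates can be transported along such isomorphisms
  (\<open>chart_transport\<close>). The second point is rigidity (\<open>chart_rigid\<close>): two coordinate systems on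
  one apartment that agree on a chamber are equal, since each coordinate of a point can be read
  off from the order alone, using the chamber. Together they give every point of the building
  well-defined coordinates relative to a chamber \<open>C\<close> of a fixed apartment, computed in any
  apartment that contains \<open>C\<close> and the point. As each edge lies in an apartment together with
  \<open>C\<close>, the resulting retraction is monotone (\<open>retract_above\<close>, \<open>retract_below\<close>), and so the
  order of the building restricts to the coordinate order on each apartment (\<open>chart_le_iff\<close>).

  For joins, let \<open>p\<close>, \<open>q\<close> lie over an apartment, let \<open>j\<close> be the componentwise maximum of
  their positions, and choose the chamber \<open>C\<close> so that it contains the vertex of \<open>j\<close>. If \<open>u\<close> is
  an upper bound of \<open>p\<close> and \<open>q\<close>, its retraction is above \<open>p\<close> and \<open>q\<close>, hence above \<open>j\<close>; but
  \<open>j\<close> and \<open>u\<close> lie over a common apartment in which these coordinates are computed, so \<open>j\<close> is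
  below \<open>u\<close> (\<open>chart_join\<close>). Meets are dual. Modularity holds since the function
  \<open>rank (x, k) = col x + k n\<close> is a strictly monotone valuation, and the ascending operator is
  \<open>(x, k) \<mapsto> (x, k + 1)\<close>. Finally, a simplex of an apartment is a finite set of vertices whose
  positions pairwise satisfy \<open>z \<le> w \<le> z + \<one>\<close> up to exchanging \<open>z\<close> and \<open>w\<close>; these are the relations
  within a short chain, and the axiom on common apartments extends the correspondence to the building one
  vertex at a time (\<open>close_chain_simplex\<close>).
\<close>

section \<open>Integer vectors\<close>

definition height :: "nat \<Rightarrow> zvec \<Rightarrow> int" where
  "height n z = (\<Sum>i=1..n. z i)"

definition shift :: "nat \<Rightarrow> int \<Rightarrow> zvec \<Rightarrow> zvec" where
  "shift n k z = (\<lambda>i. z i + k * ones n i)"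

definition near :: "nat \<Rightarrow> zvec \<Rightarrow> zvec \<Rightarrow> bool" where
  "near n z w \<longleftrightarrow> z \<le> w \<and> w \<le> shift n 1 z"

lemma height_mono: "z \<le> w \<Longrightarrow> height n z \<le> height n w"
  unfolding height_def by (intro sum_mono) (auto simp: le_fun_def)

lemma height_shift: "height n (shift n k z) = height n z + k * int n"
  by (simp add: height_def shift_def ones_def sum.distrib)

lemma height_upd:
  assumes "i \<in> {1..n}"
  shows "height n (z(i := z i + c)) = height n z + c"
proof -
  have "height n (z(i := z i + c)) = (z i + c) + (\<Sum>j\<in>{1..n} - {i}. (z(i := z i + c)) j)"
    unfolding height_def using assms by (subst sum.remove[of _ i]) auto
  also have "(\<Sum>j\<in>{1..n} - {i}. (z(i := z i + c)) j) = (\<Sum>j\<in>{1..n} - {i}. z j)"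
    by (intro sum.cong) auto
  also have "z i + c + (\<Sum>j\<in>{1..n} - {i}. z j) = height n z + c"
    unfolding height_def using assms by (subst sum.remove[of "{1..n}" i z]) auto
  finally show ?thesis .
qed

lemma shift_in_Zn: "z \<in> Zn n \<Longrightarrow> shift n k z \<in> Zn n"
  by (auto simp: Zn_def shift_def ones_def)

lemma upd_in_Zn: "z \<in> Zn n \<Longrightarrow> i \<in> {1..n} \<Longrightarrow> z(i := a) \<in> Zn n"
  by (auto simp: Zn_def)

lemma shift_shift: "shift n k (shift n l z) = shift n (l + k) z"
  by (auto simp: shift_def ones_def)

lemma shift_0 [simp]: "shift n 0 z = z"
  by (simp add: shift_def)

lemma shift_le_shift: "shift n k z \<le> shift n k w \<longleftrightarrow> z \<le> w"
  by (auto simp: shift_def le_fun_def)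

lemma shift_mono: "k \<le> l \<Longrightarrow> shift n k z \<le> shift n l z"
  by (auto simp: shift_def ones_def le_fun_def)

lemma near_refl: "near n z z"
  using shift_mono[of 0 1 n z] by (simp add: near_def)

lemma Zn_le_eqI:
  assumes "z \<in> Zn n" "w \<in> Zn n" "z \<le> w" "height n w \<le> height n z"
  shows "z = w"
proof
  fix i
  show "z i = w i"
  proof (cases "i \<in> {1..n}")
    case True
    have "height n w = height n z"
      using assms height_mono by (simp add: antisym)
    moreover have "\<And>j. j \<in> {1..n} \<Longrightarrow> z j \<le> w j"
      using assms by (auto simp: le_fun_def)
    ultimately show ?thesis
      using True sum_mono_inv[of z "{1..n}" w i] by (auto simp: height_def)
  qed (use assms in \<open>auto simp: Zn_def\<close>)
qed

lemma Zn_less_step: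
  assumes "z \<in> Zn n" "w \<in> Zn n" "z \<le> w" "z \<noteq> w"
  obtains i where "i \<in> {1..n}" "z(i := z i + 1) \<le> w"
proof -
  obtain i where i: "z i \<noteq> w i"
    using assms by blast
  moreover have "i \<in> {1..n}"
    using i assms by (auto simp: Zn_def)
  moreover have "z(i := z i + 1) \<le> w"
    using assms i by (auto simp: le_fun_def) (metis order_le_imp_less_or_eq zless_imp_add1_zle)
  ultimately show thesis
    using that by blast
qed

lemma Zn_cover:
  assumes "z \<in> Zn n" "w \<in> Zn n" "z \<le> w" "height n w = height n z + 1"
  obtains i where "i \<in> {1..n}" "w = z(i := z i + 1)"
proof -
  have "z \<noteq> w"
    using assms by auto
  then obtain i where i: "i \<in> {1..n}" "z(i := z i + 1) \<le> w"
    using Zn_less_step assms by blast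
  then have "z(i := z i + 1) = w"
    using assms by (intro Zn_le_eqI[of _ n]) (auto simp: height_upd upd_in_Zn)
  then show thesis
    using that i by blast
qed

lemma sorted_wrt_between:
  assumes "sorted_wrt R xs" "x \<in> set xs"
  shows "x = hd xs \<or> R (hd xs) x" "x = last xs \<or> R x (last xs)"
proof -
  show "x = hd xs \<or> R (hd xs) x"
    using assms by (cases xs) auto
  show "x = last xs \<or> R x (last xs)"
    using assms by (cases xs rule: rev_cases) (auto simp: sorted_wrt_append)
qed

lemma sorted_wrt_comparable:
  "sorted_wrt R xs \<Longrightarrow> x \<in> set xs \<Longrightarrow> y \<in> set xs \<Longrightarrow> x = y \<or> R x y \<or> R y x"
  by (induction xs) auto

text \<open>The complex \<open>O_Lambda n\<close> is a flag complex: membership only has to be tested on pairs. This form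
is insensitive to the cyclic rotations that a chain undergoes when it is reduced modulo the
all-one vector. Comparable vectors with the same height coincide, so sorting a finite set of
pairwise comparable vectors by height recovers the chain.\<close>

lemma O_Lambda_iff:
  assumes "n \<ge> 1"
  shows "A \<in> O_Lambda n \<longleftrightarrow>
    finite A \<and> A \<subseteq> Lambda n \<and> (\<forall>x\<in>A. \<forall>y\<in>A. near n x y \<or> near n y x)"
proof
  assume "A \<in> O_Lambda n"
  then obtain xs where xs: "A = set xs" "set xs \<subseteq> Lambda n" "sorted_wrt (<) xs"
    and last: "xs \<noteq> [] \<longrightarrow> last xs < (\<lambda>i. hd xs i + ones n i)"
    by (auto simp: O_Lambda_def)
  have near: "near n x y" if "x \<in> set xs" "y \<in> set xs" "x \<le> y" for x y
  proof -
    have "y \<le> last xs"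
      using sorted_wrt_between(2)[OF xs(3) that(2)] by auto
    also have "last xs \<le> shift n 1 (hd xs)"
      using last that by (auto simp: shift_def)
    also have "\<dots> \<le> shift n 1 x"
      using sorted_wrt_between(1)[OF xs(3) that(1)] by (auto simp: shift_le_shift)
    finally show ?thesis
      using that by (simp add: near_def)
  qed
  have "x \<le> y \<or> y \<le> x" if "x \<in> set xs" "y \<in> set xs" for x y
    using sorted_wrt_comparable[OF xs(3) that] by auto
  then show "finite A \<and> A \<subseteq> Lambda n \<and> (\<forall>x\<in>A. \<forall>y\<in>A. near n x y \<or> near n y x)"
    using near xs by auto
next
  assume "finite A \<and> A \<subseteq> Lambda n \<and> (\<forall>x\<in>A. \<forall>y\<in>A. near n x y \<or> near n y x)"
  then have fin: "finite A" and A: "A \<subseteq> Lambda n"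
    and near: "\<And>x y. x \<in> A \<Longrightarrow> y \<in> A \<Longrightarrow> near n x y \<or> near n y x"
    by auto
  obtain ys where ys: "set ys = A" "distinct ys"
    using finite_distinct_list[OF fin] by blast
  define xs where "xs = sort_key (height n) ys"
  have xs: "set xs = A" "distinct xs" "sorted (map (height n) xs)"
    using ys by (auto simp: xs_def)
  have sub: "A \<subseteq> Zn n"
    using A by (auto simp: Lambda_def)
  have "xs ! i < xs ! j" if "i < j" "j < length xs" for i j
  proof -
    have mem: "xs ! i \<in> A" "xs ! j \<in> A"
      using that xs nth_mem[of i xs] nth_mem[of j xs] by auto
    have le: "height n (xs ! i) \<le> height n (xs ! j)"
      using xs(3) that by (simp add: sorted_iff_nth_mono)
    have ne: "xs ! i \<noteq> xs ! j"
      using xs(2) that by (simp add: nth_eq_iff_index_eq)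
    have "\<not> xs ! j \<le> xs ! i"
      using Zn_le_eqI[of "xs ! j" n "xs ! i"] mem sub le ne by auto
    then show ?thesis
      using near[OF mem] ne by (auto simp: near_def less_le)
  qed
  then have sorted: "sorted_wrt (<) xs"
    by (simp add: sorted_wrt_iff_nth_less)
  have "last xs < (\<lambda>i. hd xs i + ones n i)" if "xs \<noteq> []"
  proof -
    have mem: "last xs \<in> A" "hd xs \<in> A"
      using that xs by auto
    have "last xs \<le> shift n 1 (hd xs)"
      using near[OF mem] shift_mono[of 0 1 n "hd xs"] unfolding near_def
      by (metis order.trans shift_0 zero_le_one)
    moreover have "height n (last xs) < height n (shift n 1 (hd xs))"
    proof -
      have "height n (last xs) \<le> int n - 1" "0 \<le> height n (hd xs)"
        using mem A by (auto simp: Lambda_def height_def)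
      then show ?thesis
        by (simp add: height_shift)
    qed
    then have "last xs \<noteq> shift n 1 (hd xs)"
      by auto
    ultimately show ?thesis
      by (simp add: shift_def less_le)
  qed
  then show "A \<in> O_Lambda n"
    using sorted A xs by (auto simp: O_Lambda_def)
qed

lemma vertices_O_Lambda:
  assumes "n \<ge> 1"
  shows "vertices (O_Lambda n) = Lambda n"
proof
  show "vertices (O_Lambda n) \<subseteq> Lambda n"
    by (auto simp: vertices_def O_Lambda_iff[OF assms])
  have "z \<in> Lambda n \<Longrightarrow> {z} \<in> O_Lambda n" for z
    by (simp add: O_Lambda_iff[OF assms] near_refl)
  then show "Lambda n \<subseteq> vertices (O_Lambda n)"
    by (auto simp: vertices_def)
qed

text \<open>If \<open>xs\<close> enumerates \<open>{1..n}\<close>, the vectors \<open>stair xs z 0, \<dots>, stair xs z n\<close> form a maximal chain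
from \<open>z\<close> to \<open>z + \<one>\<close>; modulo the all-one vector these chains are the chambers of an apartment.\<close>

definition stair :: "nat list \<Rightarrow> zvec \<Rightarrow> nat \<Rightarrow> zvec" where
  "stair xs z m = (\<lambda>j. z j + (if j \<in> set (take m xs) then 1 else 0))"

lemma stair_height:
  assumes "distinct xs" "set xs = {1..n}" "m \<le> n"
  shows "height n (stair xs z m) = height n z + int m"
proof -
  have len: "length xs = n"
    using distinct_card[OF assms(1)] assms(2) by simp
  have "{1..n} \<inter> {j. j \<in> set (take m xs)} = set (take m xs)"
    using set_take_subset[of m xs] assms(2) by blast
  moreover have "card (set (take m xs)) = m"
    using distinct_card[of "take m xs"] assms len by simp
  ultimately show ?thesis
    by (simp add: height_def stair_def sum.distrib sum.If_cases)
qed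

lemma stair_Zn: "set xs \<subseteq> {1..n} \<Longrightarrow> z \<in> Zn n \<Longrightarrow> stair xs z m \<in> Zn n"
  using set_take_subset[of m xs] by (auto simp: Zn_def stair_def)

lemma stair_near:
  assumes "set xs \<subseteq> {1..n}" "m \<le> m'"
  shows "near n (stair xs z m) (stair xs z m')"
  using set_take_subset_set_take[OF assms(2), of xs] set_take_subset[of m' xs] assms(1)
  by (auto simp: near_def stair_def shift_def ones_def le_fun_def)

text \<open>A vector can be moved to any other one of the same height by steps that decrease one coordinate
and increase another, each reducing the \<open>\<ell>\<^sub>1\<close>-distance to the target.\<close>

lemma equal_height_connected:
  assumes swap: "\<And>z a b. z \<in> Zn n \<Longrightarrow> a \<in> {1..n} \<Longrightarrow> b \<in> {1..n} \<Longrightarrow> a \<noteq> b \<Longrightarrow>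
      d (z(a := z a + 1)) = d (z(b := z b + 1))"
    and "z \<in> Zn n" "w \<in> Zn n" "height n z = height n w"
  shows "d z = d w"
  using assms(2,4)
proof (induction "nat (\<Sum>i=1..n. \<bar>z i - w i\<bar>)" arbitrary: z rule: less_induct)
  case less
  show ?case
  proof (cases "z = w")
    case False
    have "\<not> z \<le> w" "\<not> w \<le> z"
      using Zn_le_eqI[of z n w] Zn_le_eqI[of w n z] less.prems assms(3) False by auto
    then obtain a b where ab: "w a < z a" "z b < w b"
      by (auto simp: le_fun_def not_le)
    moreover have "z i = w i" if "i \<notin> {1..n}" for i
      using less.prems(1) assms(3) that by (simp add: Zn_def)
    ultimately have mem: "a \<in> {1..n}" "b \<in> {1..n}"
      by (metis less_irrefl)+
    have "a \<noteq> b"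
      using ab by auto
    define z0 where "z0 = z(a := z a - 1)"
    define z' where "z' = z0(b := z0 b + 1)"
    have z0: "z0 \<in> Zn n" and z': "z' \<in> Zn n"
      unfolding z'_def z0_def using less.prems mem by (auto intro!: upd_in_Zn)
    have z: "z = z0(a := z0 a + 1)"
      by (simp add: z0_def)
    have "height n z' = height n z0 + 1" "height n z = height n z0 + 1"
      unfolding z'_def using height_upd[OF mem(2), of z0 1] height_upd[OF mem(1), of z0 1] z by simp_all
    then have "height n z' = height n w"
      using less.prems(2) by simp
    moreover have "(\<Sum>i=1..n. \<bar>z' i - w i\<bar>) < (\<Sum>i=1..n. \<bar>z i - w i\<bar>)"
    proof (rule sum_strict_mono_ex1)
      show "\<forall>i\<in>{1..n}. \<bar>z' i - w i\<bar> \<le> \<bar>z i - w i\<bar>"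
        using ab by (auto simp: z'_def z0_def)
      show "\<exists>i\<in>{1..n}. \<bar>z' i - w i\<bar> < \<bar>z i - w i\<bar>"
        using ab mem \<open>a \<noteq> b\<close> by (intro bexI[of _ a]) (auto simp: z'_def z0_def)
    qed simp
    then have "nat (\<Sum>i=1..n. \<bar>z' i - w i\<bar>) < nat (\<Sum>i=1..n. \<bar>z i - w i\<bar>)"
      by (subst nat_less_eq_zless) (auto intro: sum_nonneg)
    ultimately have "d z' = d w"
      using less.hyps z' by blast
    moreover have "d z = d z'"
      unfolding z'_def by (subst z) (rule swap[OF z0 mem \<open>a \<noteq> b\<close>])
    ultimately show ?thesis
      by simp
  qed simp
qed

lemma stair_Suc_0: "xs \<noteq> [] \<Longrightarrow> stair xs z (Suc 0) = z(hd xs := z (hd xs) + 1)"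
  by (cases xs) (auto simp: stair_def)

text \<open>The right-hand side speaks of the order only. Hence the \<open>i\<close>-th coordinate of \<open>v\<close> can be compared
with an integer through order relations to just two vectors, \<open>b\<close> and \<open>b + e\<^sub>i\<close>, where \<open>b\<close> has this
integer as its \<open>i\<close>-th coordinate.\<close>

lemma coordinate_iff:
  assumes "v \<in> Zn n" "b \<in> Zn n" "i \<in> {1..n}"
  shows "b i < v i \<longleftrightarrow> (\<exists>w\<in>Zn n. w \<le> v \<and> w \<le> b(i := b i + 1) \<and> \<not> w \<le> b)"
proof
  assume i: "b i < v i"
  let ?w = "\<lambda>j. min (v j) ((b(i := b i + 1)) j)"
  have "?w \<in> Zn n"
    using assms by (auto simp: Zn_def)
  moreover have "?w \<le> v" "?w \<le> b(i := b i + 1)"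
    by (auto simp: le_fun_def)
  moreover have "\<not> ?w i \<le> b i"
    using i by auto
  then have "\<not> ?w \<le> b"
    by (auto simp: le_fun_def)
  ultimately show "\<exists>w\<in>Zn n. w \<le> v \<and> w \<le> b(i := b i + 1) \<and> \<not> w \<le> b"
    by blast
next
  assume "\<exists>w\<in>Zn n. w \<le> v \<and> w \<le> b(i := b i + 1) \<and> \<not> w \<le> b"
  then obtain w where w: "w \<le> v" "w \<le> b(i := b i + 1)" "\<not> w \<le> b"
    by blast
  then obtain j where j: "b j < w j"
    by (auto simp: le_fun_def not_le)
  moreover have "w j \<le> (b(i := b i + 1)) j" "w j \<le> v j"
    using w by (auto simp: le_fun_def)
  ultimately show "b i < v i"
    by (cases "j = i") auto
qed

lemma stair_upt_step:
  assumes "i \<in> {1..n}"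
  shows "stair [1..<Suc n] z i =
    (stair [1..<Suc n] z (i - 1))(i := stair [1..<Suc n] z (i - 1) i + 1)"
proof -
  have "set (take m [1..<Suc n]) = {1..m}" if "m \<le> n" for m
    using that by (auto simp: take_upt simp del: upt_Suc)
  then show ?thesis
    using assms by (auto simp: stair_def fun_eq_iff simp del: upt_Suc)
qed

lemma stair_0: "stair xs z 0 = z"
  by (simp add: stair_def)

lemma shift_upd:
  "i \<in> {1..n} \<Longrightarrow> shift n k (z(i := z i + 1)) = (shift n k z)(i := shift n k z i + 1)"
  by (auto simp: shift_def fun_eq_iff)

section \<open>Strict valuations on lattices\<close>

text \<open>One side of the modular law is always below the other, and by the valuation property both sides
have the same value \<open>v x + v y + v z - v (x \<sqinter> z) - v (y \<squnion> z)\<close>.\<close>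

lemma (in lattice) strict_valuation_modular:
  fixes v :: "'a \<Rightarrow> int"
  assumes val: "\<And>x y. x \<in> carrier L \<Longrightarrow> y \<in> carrier L \<Longrightarrow> v (x \<squnion> y) + v (x \<sqinter> y) = v x + v y"
    and strict: "\<And>x y. x \<in> carrier L \<Longrightarrow> y \<in> carrier L \<Longrightarrow> x \<sqsubseteq> y \<Longrightarrow> v y \<le> v x \<Longrightarrow> x = y"
    and x: "x \<in> carrier L" and y: "y \<in> carrier L" and z: "z \<in> carrier L" and xy: "x \<sqsubseteq> y"
  shows "(y \<sqinter> z) \<squnion> x = (x \<squnion> z) \<sqinter> y"
proof (rule strict)
  have yz: "y \<sqinter> z \<in> carrier L" and xz: "x \<squnion> z \<in> carrier L"
    using x y z by simp_all
  show "(y \<sqinter> z) \<squnion> x \<in> carrier L" "(x \<squnion> z) \<sqinter> y \<in> carrier L"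
    using x y yz xz by simp_all
  have le: "y \<sqinter> z \<sqsubseteq> y" "y \<sqinter> z \<sqsubseteq> z" "x \<sqsubseteq> x \<squnion> z" "z \<sqsubseteq> x \<squnion> z"
    using x y z meet_left meet_right join_left join_right by simp_all
  have le': "y \<sqinter> z \<sqsubseteq> x \<squnion> z"
    using le_trans[OF le(2) le(4)] yz z xz by simp
  show "(y \<sqinter> z) \<squnion> x \<sqsubseteq> (x \<squnion> z) \<sqinter> y"
    using x y yz xz le le' xy by (intro join_le meet_le) simp_all
  have "(y \<sqinter> z) \<sqinter> x = x \<sqinter> z"
  proof (rule le_antisym)
    have "(y \<sqinter> z) \<sqinter> x \<sqsubseteq> z"
      using le_trans[OF meet_left[OF yz x] le(2)] yz x z by simp
    then show "(y \<sqinter> z) \<sqinter> x \<sqsubseteq> x \<sqinter> z"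
      using x yz z by (intro meet_le) (simp_all add: meet_right)
    have "x \<sqinter> z \<sqsubseteq> y"
      using le_trans[OF meet_left[OF x z] xy] x y z by simp
    then show "x \<sqinter> z \<sqsubseteq> (y \<sqinter> z) \<sqinter> x"
      using x y z yz by (intro meet_le) (simp_all add: meet_left meet_right)
  qed (use x yz z in simp_all)
  moreover have "(x \<squnion> z) \<squnion> y = y \<squnion> z"
  proof (rule le_antisym)
    have "x \<sqsubseteq> y \<squnion> z"
      using le_trans[OF xy join_left[OF y z]] x y z by simp
    then show "(x \<squnion> z) \<squnion> y \<sqsubseteq> y \<squnion> z"
      using x y z xz by (intro join_le) (simp_all add: join_left join_right)
    have "z \<sqsubseteq> (x \<squnion> z) \<squnion> y"
      using le_trans[OF le(4) join_left[OF xz y]] xz y z by simp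
    then show "y \<squnion> z \<sqsubseteq> (x \<squnion> z) \<squnion> y"
      using x y z xz by (intro join_le) (simp_all add: join_right)
  qed (use xz y z in simp_all)
  ultimately show "v ((x \<squnion> z) \<sqinter> y) \<le> v ((y \<sqinter> z) \<squnion> x)"
    using val[OF yz x] val[OF xz y] val[OF x z] val[OF y z] by simp
qed

section \<open>Charts of apartments\<close>

locale colored_building =
  fixes n :: nat and \<Delta> :: "'v set set" and \<A> :: "'v set set set" and col :: "'v \<Rightarrow> nat"
  assumes n_pos: "n \<ge> 1"
    and building: "affine_building n \<Delta> \<A>"
    and natural: "natural_coloring n \<Delta> \<A> col"
begin

lemma building_complex: "simplicial_complex_on (vertices \<Delta>) \<Delta>"
  using building by (simp add: affine_building_def simplicial_complex_def)

lemma simplex_subset: "A \<in> \<Delta> \<Longrightarrow> B \<subseteq> A \<Longrightarrow> B \<in> \<Delta>"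
  using building_complex by (simp add: simplicial_complex_on_def)

lemma simplex_singleton: "x \<in> vertices \<Delta> \<Longrightarrow> {x} \<in> \<Delta>"
  using building_complex by (simp add: simplicial_complex_on_def)

lemma apartment_subcomplex: "S \<in> \<A> \<Longrightarrow> subcomplex S \<Delta>"
  using building by (simp add: affine_building_def)

lemma apartment_subset: "S \<in> \<A> \<Longrightarrow> A \<in> S \<Longrightarrow> A \<in> \<Delta>"
  using apartment_subcomplex by (auto simp: subcomplex_def)

lemma apartment_singleton: "S \<in> \<A> \<Longrightarrow> x \<in> vertices S \<Longrightarrow> {x} \<in> S"
  using apartment_subcomplex
  by (simp add: subcomplex_def simplicial_complex_def simplicial_complex_on_def)

lemma simplex_vertices: "A \<in> K \<Longrightarrow> A \<subseteq> vertices K"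
  by (auto simp: vertices_def)

lemma apartment_vertices: "S \<in> \<A> \<Longrightarrow> vertices S \<subseteq> vertices \<Delta>"
  using apartment_subset by (auto simp: vertices_def)

lemma common_apartment:
  assumes "A \<in> \<Delta>" "B \<in> \<Delta>"
  obtains S where "S \<in> \<A>" "A \<in> S" "B \<in> S"
proof -
  have "\<forall>A\<in>\<Delta>. \<forall>B\<in>\<Delta>. \<exists>S\<in>\<A>. A \<in> S \<and> B \<in> S"
    using building by (simp add: affine_building_def)
  then show thesis
    using that assms by blast
qed

lemma apartment_iso:
  assumes "S \<in> \<A>" "S' \<in> \<A>" "A \<in> S" "B \<in> S" "A \<in> S'" "B \<in> S'"
  obtains f where "complex_iso f S S'" "\<And>x. x \<in> A \<union> B \<Longrightarrow> f x = x"
proof -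
  have "\<forall>S\<in>\<A>. \<forall>S'\<in>\<A>. \<forall>A B. A \<in> S \<and> B \<in> S \<and> A \<in> S' \<and> B \<in> S' \<longrightarrow>
      (\<exists>f. complex_iso f S S' \<and> (\<forall>x\<in>A \<union> B. f x = x))"
    using building by (simp add: affine_building_def)
  then have "\<exists>f. complex_iso f S S' \<and> (\<forall>x\<in>A \<union> B. f x = x)"
    using assms by blast
  then show thesis
    using that by blast
qed

lemma col_less: "x \<in> vertices \<Delta> \<Longrightarrow> col x < n"
  using natural by (auto simp: natural_coloring_def coloring_def)

lemma col_inj: "A \<in> \<Delta> \<Longrightarrow> inj_on col A"
  using natural by (auto simp: natural_coloring_def coloring_def)

text \<open>Apartments are only assumed to be subcomplexes. That they contain every edge of the building
between their vertices follows by mapping an apartment through the edge isomorphically to the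
given one with both end points fixed.\<close>

lemma edge_in_apartment:
  assumes "S \<in> \<A>" "x \<in> vertices S" "y \<in> vertices S" "{x, y} \<in> \<Delta>"
  shows "{x, y} \<in> S"
proof -
  obtain S' where S': "S' \<in> \<A>" "{x, y} \<in> S'"
    using common_apartment assms by blast
  then have "x \<in> vertices S'" "y \<in> vertices S'"
    by (auto simp: vertices_def)
  then obtain f where f: "complex_iso f S' S" "\<And>z. z \<in> {x} \<union> {y} \<Longrightarrow> f z = z"
    using apartment_iso[of S' S "{x}" "{y}"] assms S' apartment_singleton by metis
  have "{x, y} \<subseteq> vertices S'"
    using S' by (auto simp: vertices_def)
  then have "f ` {x, y} \<in> S"
    using f(1) S' unfolding complex_iso_def by blast
  then show ?thesis
    using f(2) by simp
qed

definition rank :: "'v \<times> int \<Rightarrow> int" where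
  "rank p = int (col (fst p)) + snd p * int n"

definition points :: "'v set set \<Rightarrow> ('v \<times> int) set" where
  "points S = vertices S \<times> UNIV"

definition up :: "(('v \<times> int) \<times> ('v \<times> int)) set" where
  "up = (building_edges n \<Delta> col)\<inverse>"

text \<open>The coordinate systems that a natural coloring provides. An apartment has many of them, and all
isomorphisms compatible with the coloring are admitted.\<close>

definition chart :: "'v set set \<Rightarrow> ('v \<Rightarrow> zvec) \<Rightarrow> bool" where
  "chart S \<rho> \<longleftrightarrow> S \<in> \<A> \<and> complex_iso \<rho> S (O_Lambda n) \<and>
     (\<forall>x\<in>vertices S. int (col x) = height n (\<rho> x))"

definition pos :: "('v \<Rightarrow> zvec) \<Rightarrow> 'v \<times> int \<Rightarrow> zvec" where
  "pos \<rho> p = shift n (snd p) (\<rho> (fst p))"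

lemma points_iff: "p \<in> points S \<longleftrightarrow> fst p \<in> vertices S"
  by (cases p) (auto simp: points_def)

lemma up_iff: "(p, q) \<in> up \<longleftrightarrow> {fst p, fst q} \<in> \<Delta> \<and> rank q = rank p + 1"
proof -
  obtain x k y l where pq: "p = (x, k)" "q = (y, l)"
    by (meson surj_pair)
  have "{x, y} \<in> \<Delta> \<longleftrightarrow> (\<exists>A\<in>\<Delta>. x \<in> A \<and> y \<in> A)"
    using simplex_subset[of _ "{x, y}"] by blast
  moreover have "x \<in> vertices \<Delta> \<and> y \<in> vertices \<Delta>" if "{x, y} \<in> \<Delta>"
    using that by (auto simp: vertices_def)
  moreover have "(y, l) \<noteq> (x, k)" if "int (col y) + l * int n = int (col x) + k * int n + 1"
    using that by auto
  ultimately show ?thesis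
    unfolding pq up_def building_edges_def rank_def by simp blast
qed

lemma rank_mono: "(p, q) \<in> up\<^sup>* \<Longrightarrow> rank p \<le> rank q"
  by (induction rule: rtrancl_induct) (auto simp: up_iff)

lemma rank_eq: "(p, q) \<in> up\<^sup>* \<Longrightarrow> rank q \<le> rank p \<Longrightarrow> p = q"
  by (erule rtranclE) (auto dest: rank_mono simp: up_iff)

lemma chart_exists:
  assumes "S \<in> \<A>"
  obtains \<rho> where "chart S \<rho>"
proof -
  have "\<exists>\<rho>. complex_iso \<rho> S (O_Lambda n) \<and> (\<forall>x\<in>vertices S. int (col x) = height n (\<rho> x))"
    using natural assms by (simp add: natural_coloring_def height_def)
  then show thesis
    using that assms by (auto simp: chart_def)
qed

lemma chart_apartment: "chart S \<rho> \<Longrightarrow> S \<in> \<A>"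
  by (simp add: chart_def)

lemma chart_Lambda: "chart S \<rho> \<Longrightarrow> x \<in> vertices S \<Longrightarrow> \<rho> x \<in> Lambda n"
  using vertices_O_Lambda[OF n_pos] by (auto simp: chart_def complex_iso_def bij_betw_def)

lemma chart_Zn: "chart S \<rho> \<Longrightarrow> x \<in> vertices S \<Longrightarrow> \<rho> x \<in> Zn n"
  using chart_Lambda by (auto simp: Lambda_def)

lemma chart_height: "chart S \<rho> \<Longrightarrow> x \<in> vertices S \<Longrightarrow> height n (\<rho> x) = int (col x)"
  by (simp add: chart_def)

lemma pos_height: "chart S \<rho> \<Longrightarrow> p \<in> points S \<Longrightarrow> height n (pos \<rho> p) = rank p"
  by (auto simp: pos_def rank_def height_shift chart_height points_iff)

lemma pos_Zn: "chart S \<rho> \<Longrightarrow> p \<in> points S \<Longrightarrow> pos \<rho> p \<in> Zn n"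
  by (auto simp: pos_def shift_in_Zn chart_Zn points_iff)

lemma pos_shift: "pos \<rho> (fst p, snd p + k) = shift n k (pos \<rho> p)"
  by (simp add: pos_def shift_shift)

lemma chart_bij:
  assumes "chart S \<rho>"
  shows "bij_betw \<rho> (vertices S) (Lambda n)"
  using assms vertices_O_Lambda[OF n_pos] by (auto simp: chart_def complex_iso_def)

lemma rank_unique:
  assumes "x \<in> vertices \<Delta>" "y \<in> vertices \<Delta>" "rank (x, k) = rank (y, l)"
  shows "k = l" "col x = col y"
proof -
  have div: "rank (x, k) div int n = k" if "x \<in> vertices \<Delta>" for x k
    using col_less[OF that] n_pos by (simp add: rank_def)
  show "k = l"
    using div[OF assms(1), of k] div[OF assms(2), of l] assms(3) by simp
  then show "col x = col y"
    using assms(3) by (simp add: rank_def)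
qed

lemma pos_inj:
  assumes "chart S \<rho>"
  shows "inj_on (pos \<rho>) (points S)"
proof (rule inj_onI)
  fix p q
  assume p: "p \<in> points S" and q: "q \<in> points S" and eq: "pos \<rho> p = pos \<rho> q"
  have "rank p = rank q"
    using pos_height[OF assms] p q eq by metis
  then have k: "snd p = snd q"
    using rank_unique[of "fst p" "fst q" "snd p" "snd q"] p q
      apartment_vertices[OF chart_apartment[OF assms]] by (auto simp: points_iff)
  then have "\<rho> (fst p) = \<rho> (fst q)"
    using eq by (auto simp: pos_def shift_def fun_eq_iff)
  then show "p = q"
    using k p q chart_bij[OF assms] by (auto simp: points_iff bij_betw_def inj_on_def prod_eq_iff)
qed

lemma pos_surj:
  assumes "chart S \<rho>" "z \<in> Zn n"
  obtains p where "p \<in> points S" "pos \<rho> p = z"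
proof -
  define k where "k = height n z div int n"
  have "height n (shift n (- k) z) = height n z mod int n"
    unfolding height_shift k_def by (simp add: minus_div_mult_eq_mod [symmetric])
  moreover have "0 \<le> height n z mod int n" "height n z mod int n < int n"
    using n_pos by auto
  ultimately have "shift n (- k) z \<in> Lambda n"
    using assms shift_in_Zn by (auto simp: Lambda_def height_def)
  then obtain x where "x \<in> vertices S" "\<rho> x = shift n (- k) z"
    using chart_bij[OF assms(1)] by (metis bij_betw_imp_surj_on imageE)
  then show thesis
    using that[of "(x, k)"] by (simp add: points_iff pos_def shift_shift)
qed

lemma chart_simplex:
  assumes "chart S \<rho>" "A \<subseteq> vertices S"
  shows "A \<in> S \<longleftrightarrow> finite A \<and> (\<forall>x\<in>A. \<forall>y\<in>A. near n (\<rho> x) (\<rho> y) \<or> near n (\<rho> y) (\<rho> x))"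
proof -
  have "A \<in> S \<longleftrightarrow> \<rho> ` A \<in> O_Lambda n"
    using assms by (auto simp: chart_def complex_iso_def)
  moreover have "finite (\<rho> ` A) \<longleftrightarrow> finite A"
    using chart_bij[OF assms(1)] assms(2) by (meson bij_betw_def finite_image_iff inj_on_subset)
  moreover have "\<rho> ` A \<subseteq> Lambda n"
    using chart_Lambda[OF assms(1)] assms(2) by auto
  ultimately show ?thesis
    by (auto simp: O_Lambda_iff[OF n_pos])
qed

text \<open>Heights of vertices lie in \<open>{0..<n}\<close>, so the second components of \<open>p\<close> and \<open>q\<close> differ by \<open>0\<close>
or \<open>1\<close>. In the latter case reduction to second component \<open>0\<close> reverses the order, which is why
the conclusion is a disjunction.\<close>

lemma near_pos:
  assumes "chart S \<rho>" "p \<in> points S" "q \<in> points S" "near n (pos \<rho> p) (pos \<rho> q)"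
  shows "near n (\<rho> (fst p)) (\<rho> (fst q)) \<or> near n (\<rho> (fst q)) (\<rho> (fst p))"
proof -
  obtain x k y l where pq: "p = (x, k)" "q = (y, l)"
    by (meson surj_pair)
  have le: "shift n k (\<rho> x) \<le> shift n l (\<rho> y)" "shift n l (\<rho> y) \<le> shift n (k + 1) (\<rho> x)"
    using assms pq by (auto simp: near_def pos_def shift_shift)
  have "int (col x) < int n" "int (col y) < int n"
    using assms pq col_less apartment_vertices chart_apartment by (auto simp: points_iff)
  moreover have "int (col x) + k * int n \<le> int (col y) + l * int n"
    "int (col y) + l * int n \<le> int (col x) + (k + 1) * int n"
    using height_mono[OF le(1), of n] height_mono[OF le(2), of n] assms pq
    by (auto simp: height_shift chart_height points_iff)
  ultimately have "(k - l) * int n < 1 * int n" "(l - k) * int n < 2 * int n"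
    by (auto simp: algebra_simps)
  then have "k - l < 1" "l - k < 2"
    by (auto simp: mult_less_cancel_right)
  then consider "l = k" | "l = k + 1"
    by linarith
  then show ?thesis
  proof cases
    case 1
    then show ?thesis
      using le shift_le_shift[of n k "\<rho> y" "shift n 1 (\<rho> x)"]
      by (auto simp: near_def pq shift_le_shift shift_shift add.commute)
  next
    case 2
    then show ?thesis
      using le shift_le_shift[of n k "\<rho> x" "shift n 1 (\<rho> y)"]
      by (auto simp: near_def pq shift_le_shift shift_shift add.commute)
  qed
qed

lemma near_simplex:
  assumes "chart S \<rho>" "P \<subseteq> points S" "finite P"
    and "\<And>p q. p \<in> P \<Longrightarrow> q \<in> P \<Longrightarrow> near n (pos \<rho> p) (pos \<rho> q) \<or> near n (pos \<rho> q) (pos \<rho> p)"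
  shows "fst ` P \<in> S"
proof -
  have "fst ` P \<subseteq> vertices S"
    using assms(2) by (auto simp: points_iff)
  moreover have "near n (\<rho> (fst p)) (\<rho> (fst q)) \<or> near n (\<rho> (fst q)) (\<rho> (fst p))"
    if "p \<in> P" "q \<in> P" for p q
    using near_pos[OF assms(1)] assms(2) assms(4)[OF that] that by blast
  ultimately show ?thesis
    using assms(3) by (auto simp: chart_simplex[OF assms(1)])
qed

text \<open>This describes the edges over an apartment as the covering pairs of \<open>\<int>\<^sup>n\<close>. Adjacency of two
vertices allows either order of their coordinate vectors; the rank condition decides between
them through the difference of the second components.\<close>

lemma chart_up_iff:
  assumes S: "chart S \<rho>" and p: "p \<in> points S" and q: "q \<in> points S"
  shows "(p, q) \<in> up \<longleftrightarrow> pos \<rho> p \<le> pos \<rho> q \<and> rank q = rank p + 1"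
proof
  assume up: "(p, q) \<in> up"
  obtain x k y l where pq: "p = (x, k)" "q = (y, l)"
    by (meson surj_pair)
  have xy: "x \<in> vertices S" "y \<in> vertices S"
    using p q pq by (auto simp: points_iff)
  then have col: "int (col x) < int n" "int (col y) < int n"
    using col_less apartment_vertices[OF chart_apartment[OF S]] by auto
  have rank: "int (col y) + l * int n = int (col x) + k * int n + 1"
    using up pq by (auto simp: up_iff rank_def)
  have "{x, y} \<in> S"
    using edge_in_apartment[OF chart_apartment[OF S]] xy up pq by (simp add: up_iff)
  then consider "near n (\<rho> x) (\<rho> y)" | "near n (\<rho> y) (\<rho> x)"
    using chart_simplex[OF S, of "{x, y}"] xy by auto
  then have "shift n k (\<rho> x) \<le> shift n l (\<rho> y)"
  proof cases
    case 1
    have "(k - l) * int n < 1 * int n"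
      using rank col by (auto simp: algebra_simps)
    then have "k - l < 1"
      using mult_right_less_imp_less[of "k - l" "int n" 1] by simp
    then have "shift n k (\<rho> x) \<le> shift n l (\<rho> x)"
      by (intro shift_mono) auto
    also have "\<dots> \<le> shift n l (\<rho> y)"
      using 1 by (simp add: near_def shift_le_shift)
    finally show ?thesis .
  next
    case 2
    then have "height n (\<rho> y) \<le> height n (\<rho> x)"
      by (intro height_mono) (simp add: near_def)
    then have "(k - l) * int n < 0 * int n"
      using rank chart_height[OF S] xy by (auto simp: algebra_simps)
    then have "k - l < 0"
      using mult_right_less_imp_less[of "k - l" "int n" 0] by simp
    have "shift n k (\<rho> x) \<le> shift n k (shift n 1 (\<rho> y))"
      using 2 by (simp add: near_def shift_le_shift)
    also have "\<dots> \<le> shift n l (\<rho> y)"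
      unfolding shift_shift using \<open>k - l < 0\<close> by (intro shift_mono) auto
    finally show ?thesis .
  qed
  then show "pos \<rho> p \<le> pos \<rho> q \<and> rank q = rank p + 1"
    using up by (simp add: pos_def pq up_iff)
next
  assume *: "pos \<rho> p \<le> pos \<rho> q \<and> rank q = rank p + 1"
  then obtain i where i: "i \<in> {1..n}" "pos \<rho> q = (pos \<rho> p)(i := pos \<rho> p i + 1)"
    using Zn_cover[OF pos_Zn[OF S p] pos_Zn[OF S q]] pos_height[OF S] p q by metis
  then have near: "near n (pos \<rho> p) (pos \<rho> q)"
    by (auto simp: near_def shift_def ones_def le_fun_def)
  have "fst ` {p, q} \<in> S"
    using near near_refl p q by (intro near_simplex[OF S]) auto
  then show "(p, q) \<in> up"
    using apartment_subset[OF chart_apartment[OF S]] * by (auto simp: up_iff)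
qed

lemma chart_path_induct [consumes 4, case_names refl step]:
  assumes S: "chart S \<rho>" and p: "p \<in> points S" and q: "q \<in> points S"
    and le: "pos \<rho> p \<le> pos \<rho> q" and refl: "P p"
    and step: "\<And>u v. u \<in> points S \<Longrightarrow> v \<in> points S \<Longrightarrow> (u, v) \<in> up \<Longrightarrow> P u \<Longrightarrow> P v"
  shows "P q"
  using p le refl
proof (induction "nat (rank q - rank p)" arbitrary: p)
  case 0
  then have "height n (pos \<rho> q) \<le> height n (pos \<rho> p)"
    using pos_height[OF S] q by simp
  then have "pos \<rho> p = pos \<rho> q"
    using Zn_le_eqI[OF pos_Zn[OF S] pos_Zn[OF S]] 0 q by blast
  then show ?case
    using pos_inj[OF S] 0 q by (auto simp: inj_on_def)
next
  case (Suc m)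
  have "pos \<rho> p \<noteq> pos \<rho> q"
    using Suc(2) pos_height[OF S Suc.prems(1)] pos_height[OF S q] by auto
  then obtain i where i: "i \<in> {1..n}" "(pos \<rho> p)(i := pos \<rho> p i + 1) \<le> pos \<rho> q"
    using Zn_less_step[OF pos_Zn[OF S] pos_Zn[OF S]] Suc.prems q by metis
  obtain p' where p': "p' \<in> points S" "pos \<rho> p' = (pos \<rho> p)(i := pos \<rho> p i + 1)"
    using pos_surj[OF S] upd_in_Zn i pos_Zn[OF S] Suc.prems by metis
  have "height n (pos \<rho> p') = height n (pos \<rho> p) + 1"
    using p' height_upd i by metis
  then have rank: "rank p' = rank p + 1"
    using pos_height[OF S p'(1)] pos_height[OF S Suc.prems(1)] by simp
  moreover have "pos \<rho> p \<le> pos \<rho> p'"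
    using p' by (auto simp: le_fun_def)
  ultimately have "(p, p') \<in> up"
    using chart_up_iff[OF S] Suc.prems p' by blast
  then have "P p'"
    using step Suc.prems p' by blast
  moreover have "m = nat (rank q - rank p')"
    using Suc(2) rank by simp
  ultimately show ?case
    using Suc(1)[of p'] p' i by metis
qed

lemma chart_le_up:
  assumes "chart S \<rho>" "p \<in> points S" "q \<in> points S" "pos \<rho> p \<le> pos \<rho> q"
  shows "(p, q) \<in> up\<^sup>*"
  using assms by (induction rule: chart_path_induct) (auto intro: rtrancl_into_rtrancl)

text \<open>Edges do not depend on the coordinate system, hence neither does the order that they generate
over the apartment.\<close>

lemma chart_le_chart:
  assumes S: "chart S \<rho>" and S': "chart S \<rho>'" and p: "p \<in> points S" and q: "q \<in> points S"
  shows "pos \<rho> p \<le> pos \<rho> q \<longleftrightarrow> pos \<rho>' p \<le> pos \<rho>' q"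
proof -
  have "pos \<tau> p \<le> pos \<tau> q" if "chart S \<sigma>" "chart S \<tau>" "pos \<sigma> p \<le> pos \<sigma> q" for \<sigma> \<tau>
    using that(1) p q that(3)
  proof (induction rule: chart_path_induct)
    case (step u v)
    then show ?case
      using chart_up_iff[OF that(2)] by (meson order.trans)
  qed simp
  then show ?thesis
    using S S' by blast
qed

section \<open>Isomorphisms of apartments and colours\<close>

text \<open>The vertex of the apartment at a vector, which depends on the vector only modulo the all-one
vector.\<close>

definition vertex_at :: "'v set set \<Rightarrow> ('v \<Rightarrow> zvec) \<Rightarrow> zvec \<Rightarrow> 'v" where
  "vertex_at S \<rho> z = fst (inv_into (points S) (pos \<rho>) z)"

lemma vertex_at_pos: "chart S \<rho> \<Longrightarrow> p \<in> points S \<Longrightarrow> vertex_at S \<rho> (pos \<rho> p) = fst p"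
  by (simp add: vertex_at_def pos_inj)

lemma vertex_at_point:
  assumes "chart S \<rho>" "z \<in> Zn n"
  obtains k where "vertex_at S \<rho> z \<in> vertices S" "(vertex_at S \<rho> z, k) \<in> points S"
    "pos \<rho> (vertex_at S \<rho> z, k) = z"
proof -
  obtain x k where xk: "(x, k) \<in> points S" "pos \<rho> (x, k) = z"
    using pos_surj[OF assms] by (metis surj_pair)
  then have "vertex_at S \<rho> z = x"
    using vertex_at_pos[OF assms(1) xk(1)] by simp
  then show thesis
    using that[of k] xk by (simp add: points_iff)
qed

lemma vertex_at_near:
  assumes S: "chart S \<rho>" and Z: "finite Z" "Z \<subseteq> Zn n"
    and near: "\<And>z w. z \<in> Z \<Longrightarrow> w \<in> Z \<Longrightarrow> near n z w \<or> near n w z"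
  shows "vertex_at S \<rho> ` Z \<in> S"
proof -
  let ?P = "inv_into (points S) (pos \<rho>) ` Z"
  have im: "Zn n = pos \<rho> ` points S"
    using pos_surj[OF S] pos_Zn[OF S] by blast
  have "fst ` ?P \<in> S"
  proof (rule near_simplex[OF S])
    show "?P \<subseteq> points S"
      by (intro image_subsetI inv_into_into) (use Z im in blast)
    fix p q
    assume "p \<in> ?P" "q \<in> ?P"
    then have "pos \<rho> p \<in> Z" "pos \<rho> q \<in> Z"
      using Z im by (auto simp: f_inv_into_f subset_iff)
    then show "near n (pos \<rho> p) (pos \<rho> q) \<or> near n (pos \<rho> q) (pos \<rho> p)"
      by (rule near)
  qed (use Z in auto)
  then show ?thesis
    by (simp add: image_image vertex_at_def)
qed

lemma stair_simplex:
  assumes "chart S \<rho>" "z \<in> Zn n" "set xs = {1..n}"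
  shows "(\<lambda>m. vertex_at S \<rho> (stair xs z m)) ` {..n} \<in> S"
proof -
  have "vertex_at S \<rho> ` (stair xs z ` {..n}) \<in> S"
  proof (rule vertex_at_near[OF assms(1)])
    show "stair xs z ` {..n} \<subseteq> Zn n"
      using assms stair_Zn by auto
    fix u v
    assume "u \<in> stair xs z ` {..n}" "v \<in> stair xs z ` {..n}"
    then obtain i j where "u = stair xs z i" "v = stair xs z j"
      by auto
    then show "near n u v \<or> near n v u"
      using stair_near[of xs n i j z] stair_near[of xs n j i z] assms(3) by (cases "i \<le> j") auto
  qed simp
  then show ?thesis
    by (simp add: image_image)
qed

lemma stair_vertex_inj:
  assumes S: "chart S \<rho>" and z: "z \<in> Zn n" and xs: "distinct xs" "set xs = {1..n}"
  shows "inj_on (\<lambda>m. vertex_at S \<rho> (stair xs z m)) {..<n}"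
proof (rule inj_onI)
  fix i j
  assume ij: "i \<in> {..<n}" "j \<in> {..<n}"
    and eq: "vertex_at S \<rho> (stair xs z i) = vertex_at S \<rho> (stair xs z j)"
  obtain k where k: "(vertex_at S \<rho> (stair xs z i), k) \<in> points S"
      "pos \<rho> (vertex_at S \<rho> (stair xs z i), k) = stair xs z i"
    using vertex_at_point[OF S stair_Zn[of xs n z i]] z xs by auto
  obtain l where l: "(vertex_at S \<rho> (stair xs z j), l) \<in> points S"
      "pos \<rho> (vertex_at S \<rho> (stair xs z j), l) = stair xs z j"
    using vertex_at_point[OF S stair_Zn[of xs n z j]] z xs by auto
  have "height n z + int i = int (col (vertex_at S \<rho> (stair xs z j))) + k * int n"
    using pos_height[OF S k(1)] stair_height[OF xs, of i z] ij unfolding k(2)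
    by (simp add: rank_def eq)
  moreover have "height n z + int j = int (col (vertex_at S \<rho> (stair xs z j))) + l * int n"
    using pos_height[OF S l(1)] stair_height[OF xs, of j z] ij unfolding l(2)
    by (simp add: rank_def)
  ultimately have "int i - int j = (k - l) * int n"
    by (simp add: algebra_simps)
  then have "(int i - int j) mod int n = 0"
    by simp
  then have "int i mod int n = int j mod int n"
    by (simp add: mod_eq_dvd_iff mod_0_imp_dvd)
  then show "i = j"
    using ij by simp
qed

text \<open>The image of a chamber is a simplex with \<open>n\<close> vertices, so it uses each of the \<open>n\<close> colors once.\<close>

lemma chamber_colours:
  assumes S: "chart S \<rho>" and f: "complex_iso f S S'" and S': "S' \<in> \<A>"
    and z: "z \<in> Zn n" and xs: "distinct xs" "set xs = {1..n}"
  shows "bij_betw (\<lambda>m. col (f (vertex_at S \<rho> (stair xs z m)))) {..<n} {..<n}"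
proof -
  let ?v = "\<lambda>m. vertex_at S \<rho> (stair xs z m)"
  have C: "?v ` {..n} \<in> S"
    by (rule stair_simplex[OF S z xs(2)])
  then have sub: "?v ` {..n} \<subseteq> vertices S"
    by (rule simplex_vertices)
  have "f ` ?v ` {..n} \<in> S'"
    using C sub f by (simp add: complex_iso_def)
  then have fC: "f ` ?v ` {..n} \<in> \<Delta>"
    by (rule apartment_subset[OF S'])
  have "inj_on f (?v ` {..n})"
    using f sub inj_on_subset by (auto simp: complex_iso_def bij_betw_def)
  then have "inj_on f (?v ` {..<n})"
    by (rule inj_on_subset) auto
  moreover have "inj_on col (f ` ?v ` {..<n})"
    by (rule inj_on_subset[OF col_inj[OF fC]]) auto
  ultimately have inj: "inj_on (\<lambda>m. col (f (?v m))) {..<n}"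
    using stair_vertex_inj[OF S z xs] by (simp add: inj_on_def)
  have "(\<lambda>m. col (f (?v m))) ` {..<n} \<subseteq> {..<n}"
  proof (rule image_subsetI)
    fix m
    assume "m \<in> {..<n}"
    then have "f (?v m) \<in> vertices \<Delta>"
      by (intro subsetD[OF simplex_vertices[OF fC]] imageI) auto
    then show "col (f (?v m)) \<in> {..<n}"
      using col_less by simp
  qed
  then have "(\<lambda>m. col (f (?v m))) ` {..<n} = {..<n}"
    by (intro card_subset_eq) (auto simp: card_image[OF inj])
  then show ?thesis
    using inj by (simp add: bij_betw_def)
qed

text \<open>Starting a maximal chain with the steps \<open>a, b\<close> or \<open>b, a\<close> gives two chambers that differ in a
single vertex. Their images both use all colors, so the images of the two exchanged vertices
carry the one color missing from the common face.\<close>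

lemma iso_colour_swap:
  assumes S: "chart S \<rho>" and f: "complex_iso f S S'" and S': "S' \<in> \<A>"
    and z: "z \<in> Zn n" and ab: "a \<in> {1..n}" "b \<in> {1..n}" "a \<noteq> b"
  shows "col (f (vertex_at S \<rho> (z(a := z a + 1)))) = col (f (vertex_at S \<rho> (z(b := z b + 1))))"
proof -
  obtain ds where ds: "set ds = {1..n} - {a, b}" "distinct ds"
    using finite_distinct_list[of "{1..n} - {a, b}"] by auto
  define g where "g = (\<lambda>xs m. col (f (vertex_at S \<rho> (stair xs z m))))"
  let ?xs = "a # b # ds" and ?ys = "b # a # ds"
  have set: "set ?xs = {1..n}" "set ?ys = {1..n}"
    unfolding list.set ds(1) using ab by blast+
  have dist: "distinct ?xs" "distinct ?ys"
    using ds ab by simp_all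
  have bij: "bij_betw (g ?xs) {..<n} {..<n}" "bij_betw (g ?ys) {..<n} {..<n}"
    unfolding g_def using chamber_colours[OF S f S' z] set dist by blast+
  \<comment> \<open>the two chains differ only after the first step\<close>
  have agree: "g ?xs m = g ?ys m" if "m \<noteq> Suc 0" for m
  proof -
    have "set (take m ?xs) = set (take m ?ys)"
      using that by (cases m; cases "m - 1") auto
    then show ?thesis
      by (simp add: g_def stair_def)
  qed
  have n: "Suc 0 < n"
    using ab by auto
  then have "g ?xs (Suc 0) \<in> g ?ys ` {..<n}"
    using bij by (auto simp: bij_betw_def)
  then obtain m where m: "m < n" "g ?xs (Suc 0) = g ?ys m"
    by auto
  have "m = Suc 0"
  proof (rule ccontr)
    assume "m \<noteq> Suc 0"
    then have "g ?xs (Suc 0) = g ?xs m"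
      using m agree by simp
    then show False
      using bij(1) m n \<open>m \<noteq> Suc 0\<close> by (auto simp: bij_betw_def inj_on_def)
  qed
  then have "g ?xs (Suc 0) = g ?ys (Suc 0)"
    using m by simp
  then show ?thesis
    by (simp add: g_def stair_Suc_0)
qed

text \<open>An isomorphism of apartments may permute the colors, but it acts on the colors as a whole. If it
fixes a chamber, it therefore fixes every color; this is how \<open>chart_transport\<close> uses it.\<close>

lemma iso_colour:
  assumes S: "chart S \<rho>" and f: "complex_iso f S S'" and S': "S' \<in> \<A>"
    and xy: "x \<in> vertices S" "y \<in> vertices S" "col x = col y"
  shows "col (f x) = col (f y)"
proof -
  have v: "vertex_at S \<rho> (\<rho> v) = v" if "v \<in> vertices S" for v
    using vertex_at_pos[OF S, of "(v, 0)"] that by (simp add: points_iff pos_def)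
  have eq: "height n (\<rho> x) = height n (\<rho> y)"
    using chart_height[OF S xy(1)] chart_height[OF S xy(2)] xy(3) by simp
  have "col (f (vertex_at S \<rho> (\<rho> x))) = col (f (vertex_at S \<rho> (\<rho> y)))"
    by (rule equal_height_connected[where d = "\<lambda>z. col (f (vertex_at S \<rho> z))",
          OF _ chart_Zn[OF S xy(1)] chart_Zn[OF S xy(2)] eq])
      (rule iso_colour_swap[OF S f S'])
  then show ?thesis
    by (simp add: v xy)
qed

lemma chart_transport:
  assumes S: "chart S \<rho>" and f: "complex_iso f S S'" and S': "S' \<in> \<A>"
    and C: "C \<subseteq> vertices S" "col ` C = {..<n}" "\<And>x. x \<in> C \<Longrightarrow> f x = x"
  obtains \<rho>' where "chart S' \<rho>'" "\<And>x. x \<in> vertices S \<Longrightarrow> \<rho>' (f x) = \<rho> x"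
proof
  let ?g = "inv_into (vertices S) f"
  let ?r = "\<rho> \<circ> ?g"
  have bij: "bij_betw f (vertices S) (vertices S')"
    using f by (simp add: complex_iso_def)
  then have bij': "bij_betw ?g (vertices S') (vertices S)"
    by (rule bij_betw_inv_into)
  have \<rho>: "bij_betw \<rho> (vertices S) (vertices (O_Lambda n))"
    using S by (simp add: chart_def complex_iso_def)
  have inv: "?g (f x) = x" if "x \<in> vertices S" for x
    using bij that by (simp add: bij_betw_inv_into_left)
  have inv': "f (?g x) = x" if "x \<in> vertices S'" for x
    using bij that by (simp add: bij_betw_inv_into_right)
  have "A \<in> S' \<longleftrightarrow> ?r ` A \<in> O_Lambda n" if A: "A \<subseteq> vertices S'" for A
  proof -
    have sub: "?g ` A \<subseteq> vertices S"
      using bij' A by (auto simp: bij_betw_def)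
    have "f ` ?g ` A = A"
      using A inv' by (force simp: image_image)
    then have "A \<in> S' \<longleftrightarrow> ?g ` A \<in> S"
      using f sub by (auto simp: complex_iso_def)
    also have "\<dots> \<longleftrightarrow> \<rho> ` ?g ` A \<in> O_Lambda n"
      using S sub by (auto simp: chart_def complex_iso_def)
    finally show ?thesis
      by (simp add: image_comp)
  qed
  moreover have "bij_betw ?r (vertices S') (vertices (O_Lambda n))"
    using bij_betw_trans[OF bij' \<rho>] .
  ultimately have iso: "complex_iso ?r S' (O_Lambda n)"
    by (simp add: complex_iso_def)
  have col: "col (f x) = col x" if x: "x \<in> vertices S" for x
  proof -
    have "col x < n"
      using col_less apartment_vertices[OF chart_apartment[OF S]] x by auto
    then obtain y where y: "y \<in> C" "col y = col x"
      using C(2) by (metis imageE lessThan_iff)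
    then have "col (f x) = col (f y)"
      using iso_colour[OF S f S' x] C(1) by auto
    then show ?thesis
      using y C(3) by simp
  qed
  have "int (col x) = height n (?r x)" if x: "x \<in> vertices S'" for x
  proof -
    have g: "?g x \<in> vertices S"
      using bij' x by (auto simp: bij_betw_def)
    then show ?thesis
      using chart_height[OF S g] col[OF g] inv'[OF x] by simp
  qed
  then show "chart S' ?r"
    using iso S' by (simp add: chart_def)
  show "\<And>x. x \<in> vertices S \<Longrightarrow> ?r (f x) = \<rho> x"
    using inv by simp
qed

text \<open>A simplex that contains the vertices of the maximal chain from \<open>z\<close> to \<open>z + \<one>\<close> in the standard
order of the coordinates. It serves as the centre of a retraction.\<close>

definition frame :: "'v set set \<Rightarrow> ('v \<Rightarrow> zvec) \<Rightarrow> zvec \<Rightarrow> 'v set \<Rightarrow> bool" where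
  "frame S \<rho> z C \<longleftrightarrow> C \<in> S \<and>
     (\<forall>m\<le>n. \<exists>k. \<exists>x\<in>C. pos \<rho> (x, k) = stair [1..<Suc n] z m)"

lemma set_upt_coords: "set [1..<Suc n] = {1..n}"
  by auto

lemma frame_exists:
  assumes S: "chart S \<rho>" and z: "z \<in> Zn n"
  obtains C where "frame S \<rho> z C"
proof
  show "frame S \<rho> z ((\<lambda>m. vertex_at S \<rho> (stair [1..<Suc n] z m)) ` {..n})"
    unfolding frame_def
  proof (intro conjI allI impI)
    fix m
    assume "m \<le> n"
    moreover obtain k where "pos \<rho> (vertex_at S \<rho> (stair [1..<Suc n] z m), k) = stair [1..<Suc n] z m"
      using vertex_at_point[OF S stair_Zn[of "[1..<Suc n]" n z m]] z set_upt_coords by blast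
    ultimately show "\<exists>k. \<exists>x\<in>(\<lambda>m. vertex_at S \<rho> (stair [1..<Suc n] z m)) ` {..n}.
        pos \<rho> (x, k) = stair [1..<Suc n] z m"
      by blast
  qed (rule stair_simplex[OF S z set_upt_coords])
qed

text \<open>The heights along the chain from \<open>z\<close> run through \<open>n\<close> consecutive integers, hence through all
residues modulo \<open>n\<close>.\<close>

lemma frame_colours:
  assumes S: "chart S \<rho>" and C: "frame S \<rho> z C"
  shows "col ` C = {..<n}"
proof
  have C': "C \<in> S"
    using C by (simp add: frame_def)
  then have sub: "C \<subseteq> vertices S"
    by (rule simplex_vertices)
  then show "col ` C \<subseteq> {..<n}"
    using col_less apartment_vertices[OF chart_apartment[OF S]] by blast
  show "{..<n} \<subseteq> col ` C"
  proof
    fix c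
    assume "c \<in> {..<n}"
    then have c: "int c < int n"
      by simp
    define m where "m = nat ((int c - height n z) mod int n)"
    have m: "int m = (int c - height n z) mod int n"
      using n_pos by (simp add: m_def)
    then have "int m < int n"
      using n_pos by simp
    then have "m \<le> n"
      by simp
    then obtain x k where x: "x \<in> C" "pos \<rho> (x, k) = stair [1..<Suc n] z m"
      using C by (auto simp: frame_def)
    then have "(x, k) \<in> points S"
      using sub by (auto simp: points_iff)
    then have "int (col x) + k * int n = height n z + int m"
      using pos_height[OF S] stair_height[OF distinct_upt set_upt_coords \<open>m \<le> n\<close>] x
      by (metis fst_conv rank_def snd_conv)
    then have "(int (col x) + k * int n) mod int n = int c mod int n"
      by (simp add: m mod_simps)
    moreover have "int (col x) < int n"
      using \<open>col ` C \<subseteq> {..<n}\<close> x by auto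
    ultimately have "col x = c"
      using c by simp
    then show "c \<in> col ` C"
      using x by blast
  qed
qed

section \<open>Retractions onto apartments\<close>

text \<open>The chain contained in the frame and its translates by the all-one vector provide, for every
coordinate \<open>i\<close> and threshold \<open>t\<close>, points \<open>b\<close> and \<open>c\<close> such that \<open>b\<close> has \<open>i\<close>-th coordinate \<open>t\<close> and \<open>c\<close> lies
one step above \<open>b\<close> in direction \<open>i\<close>. By \<open>coordinate_iff\<close> the order then decides whether the \<open>i\<close>-th coordinate
of \<open>p\<close> exceeds \<open>t\<close>, and the order is the same in both coordinate systems.\<close>

lemma chart_rigid:
  assumes S: "chart S \<rho>" and S': "chart S \<rho>'" and z: "z \<in> Zn n" and C: "frame S \<rho> z C"
    and agree: "\<And>x. x \<in> C \<Longrightarrow> \<rho>' x = \<rho> x" and p: "p \<in> points S"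
  shows "pos \<rho>' p = pos \<rho> p"
proof
  fix i
  show "pos \<rho>' p i = pos \<rho> p i"
  proof (cases "i \<in> {1..n}")
    case False
    then show ?thesis
      using pos_Zn[OF S p] pos_Zn[OF S' p] by (simp add: Zn_def)
  next
    case i: True
    have sub: "C \<subseteq> vertices S"
      using C simplex_vertices by (auto simp: frame_def)
    have "t < pos \<rho>' p i \<longleftrightarrow> t < pos \<rho> p i" for t
    proof -
      have "i \<le> n" "i - 1 \<le> n"
        using i by auto
      then obtain x k x' k' where
        x: "x \<in> C" "pos \<rho> (x, k) = stair [1..<Suc n] z i" and
        x': "x' \<in> C" "pos \<rho> (x', k') = stair [1..<Suc n] z (i - 1)"
        using C unfolding frame_def by meson
      \<comment> \<open>translating by \<open>l\<close> moves the \<open>i\<close>-th coordinate to the threshold \<open>t\<close>\<close>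
      define l where "l = t - pos \<rho> (x', k') i"
      define c where "c = (x, k + l)"
      define b where "b = (x', k' + l)"
      have cb: "c \<in> points S" "b \<in> points S"
        using x x' sub by (auto simp: c_def b_def points_iff)
      have bt: "pos \<rho> b i = t"
        using pos_shift[of \<rho> "(x', k')" l] i by (simp add: b_def l_def shift_def ones_def)
      have step: "pos \<rho> c = (pos \<rho> b)(i := pos \<rho> b i + 1)"
        using pos_shift[of \<rho> "(x', k')" l] pos_shift[of \<rho> "(x, k)" l] x x'
          stair_upt_step[OF i, of z] shift_upd[OF i]
        by (simp add: c_def b_def del: upt_Suc)
      have same: "pos \<rho>' c = pos \<rho> c" "pos \<rho>' b = pos \<rho> b"
        using agree x x' by (auto simp: pos_def c_def b_def)
      have char: "t < pos \<sigma> p i \<longleftrightarrow>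
          (\<exists>w\<in>points S. pos \<sigma> w \<le> pos \<sigma> p \<and> pos \<sigma> w \<le> pos \<sigma> c \<and> \<not> pos \<sigma> w \<le> pos \<sigma> b)"
        if \<sigma>: "chart S \<sigma>" "pos \<sigma> c = pos \<rho> c" "pos \<sigma> b = pos \<rho> b" for \<sigma>
      proof -
        have "Zn n = pos \<sigma> ` points S"
          using pos_surj[OF \<sigma>(1)] pos_Zn[OF \<sigma>(1)] by blast
        then show ?thesis
          using coordinate_iff[OF pos_Zn[OF \<sigma>(1) p] pos_Zn[OF \<sigma>(1) cb(2)] i] \<sigma> step bt
          by simp
      qed
      show ?thesis
        unfolding char[OF S refl refl] char[OF S' same]
        using chart_le_chart[OF S S'] p cb by blast
    qed
    then show ?thesis
      by (metis less_irrefl linorder_neqE)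
  qed
qed

text \<open>The coordinates of the retraction centred at \<open>C\<close>: in any apartment containing \<open>C\<close>, a
coordinate system that extends the given one on \<open>C\<close>. Using all of these systems at once avoids
choosing one for each point.\<close>

definition agrees :: "('v \<Rightarrow> zvec) \<Rightarrow> 'v set \<Rightarrow> 'v set set \<Rightarrow> ('v \<Rightarrow> zvec) \<Rightarrow> bool" where
  "agrees \<rho> C S' \<rho>' \<longleftrightarrow> chart S' \<rho>' \<and> C \<in> S' \<and> (\<forall>x\<in>C. \<rho>' x = \<rho> x)"

lemma agrees_chart: "agrees \<rho> C S' \<rho>' \<Longrightarrow> chart S' \<rho>'"
  by (simp add: agrees_def)

text \<open>A coordinate system is carried from \<open>S\<close> to an apartment through \<open>C\<close> and \<open>A\<close> by an isomorphism
that fixes \<open>C\<close>.\<close>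

lemma agrees_exists:
  assumes S: "chart S \<rho>" and C: "frame S \<rho> z C" and A: "A \<in> \<Delta>"
  obtains S' \<rho>' where "agrees \<rho> C S' \<rho>'" "A \<in> S'"
proof -
  have CS: "C \<in> S"
    using C by (simp add: frame_def)
  then obtain S' where S': "S' \<in> \<A>" "C \<in> S'" "A \<in> S'"
    using common_apartment[OF _ A] apartment_subset[OF chart_apartment[OF S]] by metis
  then obtain f where f: "complex_iso f S S'" "\<And>x. x \<in> C \<union> C \<Longrightarrow> f x = x"
    using apartment_iso[OF chart_apartment[OF S] S'(1) CS CS] by metis
  obtain \<rho>' where \<rho>': "chart S' \<rho>'" "\<And>x. x \<in> vertices S \<Longrightarrow> \<rho>' (f x) = \<rho> x"
    using chart_transport[OF S f(1) S'(1) simplex_vertices[OF CS] frame_colours[OF S C]] f(2)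
    by (metis Un_iff)
  have "\<rho>' x = \<rho> x" if "x \<in> C" for x
    using \<rho>'(2)[of x] f(2)[of x] that simplex_vertices[OF CS] by auto
  then show thesis
    using that \<rho>'(1) S' by (auto simp: agrees_def)
qed

text \<open>The retraction is well defined: an isomorphism fixing \<open>C\<close> and the vertex of \<open>p\<close> reduces the
comparison to two coordinate systems on the same apartment, where rigidity applies.\<close>

lemma agrees_unique:
  assumes S: "chart S \<rho>" and z: "z \<in> Zn n" and C: "frame S \<rho> z C"
    and S1: "agrees \<rho> C S1 \<rho>1" and S2: "agrees \<rho> C S2 \<rho>2"
    and p: "p \<in> points S1" "p \<in> points S2"
  shows "pos \<rho>1 p = pos \<rho>2 p"
proof -
  have chart: "chart S1 \<rho>1" "chart S2 \<rho>2" and CS: "C \<in> S1" "C \<in> S2"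
    using S1 S2 by (auto simp: agrees_def)
  then have "{fst p} \<in> S1" "{fst p} \<in> S2"
    using p apartment_singleton chart_apartment by (auto simp: points_iff)
  then obtain f where f: "complex_iso f S1 S2" "\<And>x. x \<in> C \<union> {fst p} \<Longrightarrow> f x = x"
    using apartment_iso[of S1 S2 C "{fst p}"] chart_apartment[OF chart(1)]
      chart_apartment[OF chart(2)] CS by metis
  obtain \<rho>' where \<rho>': "chart S2 \<rho>'" "\<And>x. x \<in> vertices S1 \<Longrightarrow> \<rho>' (f x) = \<rho>1 x"
    using chart_transport[OF chart(1) f(1) chart_apartment[OF chart(2)] simplex_vertices[OF CS(1)]
        frame_colours[OF S C]] f(2) by (metis Un_iff)
  have "\<rho>' x = \<rho>2 x" if "x \<in> C" for x
    using \<rho>'(2)[of x] f(2)[of x] that simplex_vertices[OF CS(1)] S1 S2 by (auto simp: agrees_def)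
  moreover have "frame S2 \<rho>2 z C"
    using C CS S2 by (auto simp: frame_def agrees_def pos_def)
  ultimately have "pos \<rho>' p = pos \<rho>2 p"
    using chart_rigid[OF chart(2) \<rho>'(1) z _ _ p(2)] by blast
  moreover have "pos \<rho>' p = pos \<rho>1 p"
    using \<rho>'(2)[of "fst p"] f(2)[of "fst p"] p by (auto simp: pos_def points_iff)
  ultimately show ?thesis
    by simp
qed

lemma agrees_self: "chart S \<rho> \<Longrightarrow> frame S \<rho> z C \<Longrightarrow> agrees \<rho> C S \<rho>"
  by (simp add: agrees_def frame_def)

text \<open>The retraction centred at \<open>C\<close> is monotone. Along a path of edges, each edge lies in an apartment
together with \<open>C\<close>, and uniqueness glues the coordinates at the vertex shared by consecutive
edges.\<close>

lemma retract_above: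
  assumes S: "chart S \<rho>" and z: "z \<in> Zn n" and C: "frame S \<rho> z C" and p: "p \<in> points S"
    and "(p, u) \<in> up\<^sup>*" "agrees \<rho> C S' \<rho>'" "u \<in> points S'"
  shows "pos \<rho> p \<le> pos \<rho>' u"
  using assms(5-)
proof (induction arbitrary: S' \<rho>' rule: rtrancl_induct)
  case base
  then show ?case
    using agrees_unique[OF S z C agrees_self[OF S C]] p by simp
next
  case (step u v)
  then obtain T \<tau> where T: "agrees \<rho> C T \<tau>" "{fst u, fst v} \<in> T"
    using agrees_exists[OF S C] by (metis up_iff)
  then have uv: "u \<in> points T" "v \<in> points T"
    using simplex_vertices[OF T(2)] by (auto simp: points_iff)
  have "pos \<rho> p \<le> pos \<tau> u"
    by (rule step.IH[OF T(1) uv(1)])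
  also have "\<dots> \<le> pos \<tau> v"
    using chart_up_iff[OF agrees_chart[OF T(1)] uv] step.hyps by simp
  also have "\<dots> = pos \<rho>' v"
    using agrees_unique[OF S z C T(1)] uv step.prems by simp
  finally show ?case .
qed

lemma retract_below:
  assumes S: "chart S \<rho>" and z: "z \<in> Zn n" and C: "frame S \<rho> z C" and p: "p \<in> points S"
    and "(u, p) \<in> up\<^sup>*" "agrees \<rho> C S' \<rho>'" "u \<in> points S'"
  shows "pos \<rho>' u \<le> pos \<rho> p"
  using assms(5-)
proof (induction arbitrary: S' \<rho>' rule: converse_rtrancl_induct)
  case base
  then show ?case
    using agrees_unique[OF S z C agrees_self[OF S C]] p by simp
next
  case (step u v)
  then obtain T \<tau> where T: "agrees \<rho> C T \<tau>" "{fst u, fst v} \<in> T"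
    using agrees_exists[OF S C] by (metis up_iff)
  then have uv: "u \<in> points T" "v \<in> points T"
    using simplex_vertices[OF T(2)] by (auto simp: points_iff)
  have "pos \<rho>' u = pos \<tau> u"
    using agrees_unique[OF S z C _ T(1)] uv step.prems by simp
  also have "\<dots> \<le> pos \<tau> v"
    using chart_up_iff[OF agrees_chart[OF T(1)] uv] step.hyps by simp
  also have "\<dots> \<le> pos \<rho> p"
    by (rule step.IH[OF T(1) uv(2)])
  finally show ?case .
qed

lemma chart_le_iff:
  assumes S: "chart S \<rho>" and p: "p \<in> points S" and q: "q \<in> points S"
  shows "(p, q) \<in> up\<^sup>* \<longleftrightarrow> pos \<rho> p \<le> pos \<rho> q"
proof
  assume "(p, q) \<in> up\<^sup>*"
  moreover obtain C where "frame S \<rho> (pos \<rho> p) C"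
    using frame_exists[OF S pos_Zn[OF S p]] .
  ultimately show "pos \<rho> p \<le> pos \<rho> q"
    using retract_above[OF S pos_Zn[OF S p]] agrees_self[OF S] p q by blast
qed (rule chart_le_up[OF S p q])

text \<open>The chain of the frame starts at its base point, so a frame based at the position of \<open>j\<close>
contains the vertex of \<open>j\<close>.\<close>

lemma frame_centre:
  assumes S: "chart S \<rho>" and j: "j \<in> points S" and C: "frame S \<rho> (pos \<rho> j) C"
  shows "fst j \<in> C"
proof -
  obtain k x where x: "x \<in> C" "pos \<rho> (x, k) = pos \<rho> j"
    using C by (auto simp: frame_def stair_0 dest: spec[of _ 0])
  then have "(x, k) \<in> points S"
    using C simplex_vertices by (auto simp: frame_def points_iff)
  then have "(x, k) = j"
    using x(2) j pos_inj[OF S] by (auto simp: inj_on_def)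
  then show ?thesis
    using x(1) by auto
qed

lemma centred_chart:
  assumes S: "chart S \<rho>" and j: "j \<in> points S" and C: "frame S \<rho> (pos \<rho> j) C"
    and u: "u \<in> points \<Delta>"
  obtains S' \<rho>' where "agrees \<rho> C S' \<rho>'" "u \<in> points S'" "j \<in> points S'" "pos \<rho>' j = pos \<rho> j"
proof -
  obtain S' \<rho>' where S': "agrees \<rho> C S' \<rho>'" "{fst u} \<in> S'"
    using agrees_exists[OF S C simplex_singleton] u by (metis points_iff)
  then have "u \<in> points S'" "j \<in> points S'"
    using simplex_vertices[OF S'(2)] frame_centre[OF S j C] simplex_vertices[of C S']
    by (auto simp: points_iff agrees_def)
  moreover have "pos \<rho>' j = pos \<rho> j"
    using S'(1) frame_centre[OF S j C] by (simp add: agrees_def pos_def)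
  ultimately show thesis
    using that S'(1) by blast
qed

text \<open>An upper bound \<open>u\<close> need not lie in an apartment with both \<open>p\<close> and \<open>q\<close>. The retraction centred
at a chamber through \<open>j\<close> puts it above \<open>p\<close> and \<open>q\<close>, hence above \<open>j\<close>, and since \<open>j\<close> belongs to the
centre this comparison takes place in an apartment that contains both \<open>j\<close> and \<open>u\<close>.\<close>

lemma chart_join:
  assumes S: "chart S \<rho>" and pqj: "p \<in> points S" "q \<in> points S" "j \<in> points S"
    and j: "pos \<rho> j = (\<lambda>i. max (pos \<rho> p i) (pos \<rho> q i))"
    and u: "u \<in> points \<Delta>" "(p, u) \<in> up\<^sup>*" "(q, u) \<in> up\<^sup>*"
  shows "(j, u) \<in> up\<^sup>*"
proof -
  note z = pos_Zn[OF S pqj(3)]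
  obtain C where C: "frame S \<rho> (pos \<rho> j) C"
    using frame_exists[OF S z] .
  obtain S' \<rho>' where S': "agrees \<rho> C S' \<rho>'" "u \<in> points S'" "j \<in> points S'"
      "pos \<rho>' j = pos \<rho> j"
    using centred_chart[OF S pqj(3) C u(1)] .
  have "pos \<rho> p \<le> pos \<rho>' u" "pos \<rho> q \<le> pos \<rho>' u"
    using retract_above[OF S z C _ _ S'(1,2)] pqj u by auto
  then have "pos \<rho>' j \<le> pos \<rho>' u"
    unfolding S'(4) j by (simp add: le_fun_def)
  then show ?thesis
    by (rule chart_le_up[OF agrees_chart[OF S'(1)] S'(3,2)])
qed

lemma chart_meet:
  assumes S: "chart S \<rho>" and pqj: "p \<in> points S" "q \<in> points S" "j \<in> points S"
    and j: "pos \<rho> j = (\<lambda>i. min (pos \<rho> p i) (pos \<rho> q i))"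
    and u: "u \<in> points \<Delta>" "(u, p) \<in> up\<^sup>*" "(u, q) \<in> up\<^sup>*"
  shows "(u, j) \<in> up\<^sup>*"
proof -
  note z = pos_Zn[OF S pqj(3)]
  obtain C where C: "frame S \<rho> (pos \<rho> j) C"
    using frame_exists[OF S z] .
  obtain S' \<rho>' where S': "agrees \<rho> C S' \<rho>'" "u \<in> points S'" "j \<in> points S'"
      "pos \<rho>' j = pos \<rho> j"
    using centred_chart[OF S pqj(3) C u(1)] .
  have "pos \<rho>' u \<le> pos \<rho> p" "pos \<rho>' u \<le> pos \<rho> q"
    using retract_below[OF S z C _ _ S'(1,2)] pqj u by auto
  then have "pos \<rho>' u \<le> pos \<rho>' j"
    unfolding S'(4) j by (simp add: le_fun_def)
  then show ?thesis
    by (rule chart_le_up[OF agrees_chart[OF S'(1)] S'(2,3)])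
qed

lemma common_chart:
  assumes "p \<in> points \<Delta>" "q \<in> points \<Delta>"
  obtains S \<rho> where "chart S \<rho>" "p \<in> points S" "q \<in> points S"
proof -
  obtain S where S: "S \<in> \<A>" "{fst p} \<in> S" "{fst q} \<in> S"
    using common_apartment[OF simplex_singleton simplex_singleton] assms by (metis points_iff)
  then show thesis
    using chart_exists[OF S(1)] that simplex_vertices[OF S(2)] simplex_vertices[OF S(3)]
    by (auto simp: points_iff)
qed

section \<open>The modular lattice\<close>

abbreviation L :: "('v \<times> int) gorder" where
  "L \<equiv> building_poset n \<Delta> col"

lemma carrier_L: "carrier L = points \<Delta>"
  by (simp add: building_poset_def points_def)

lemma le_L: "p \<sqsubseteq>\<^bsub>L\<^esub> q \<longleftrightarrow> (p, q) \<in> up\<^sup>*"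
  by (simp add: building_poset_def up_def rtrancl_converse)

lemma eq_L: "p .=\<^bsub>L\<^esub> q \<longleftrightarrow> p = q"
  by (simp add: building_poset_def)

lemma lless_L: "p \<sqsubset>\<^bsub>L\<^esub> q \<longleftrightarrow> (p, q) \<in> up\<^sup>* \<and> p \<noteq> q"
  by (simp add: lless_def le_L eq_L)

lemma up_points: "(p, q) \<in> up \<Longrightarrow> p \<in> points \<Delta> \<and> q \<in> points \<Delta>"
  by (auto simp: up_iff points_iff dest: simplex_vertices)

lemma points_mono: "chart S \<rho> \<Longrightarrow> p \<in> points S \<Longrightarrow> p \<in> points \<Delta>"
  using apartment_vertices[OF chart_apartment] by (auto simp: points_iff)

sublocale L: partial_order L
proof unfold_locales
  show "x .=\<^bsub>L\<^esub> y" if "x \<sqsubseteq>\<^bsub>L\<^esub> y" "y \<sqsubseteq>\<^bsub>L\<^esub> x" for x y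
    using that rank_eq rank_mono unfolding le_L eq_L by blast
qed (simp_all add: le_L eq_L fun_eq_iff rtrancl_trans[of _ _ up])

lemma is_lub_iff:
  assumes "A \<subseteq> points \<Delta>"
  shows "is_lub L j A \<longleftrightarrow> j \<in> points \<Delta> \<and> (\<forall>a\<in>A. (a, j) \<in> up\<^sup>*) \<and>
    (\<forall>u\<in>points \<Delta>. (\<forall>a\<in>A. (a, u) \<in> up\<^sup>*) \<longrightarrow> (j, u) \<in> up\<^sup>*)"
  unfolding least_def Upper_def carrier_L le_L using assms by blast

lemma is_glb_iff:
  assumes "A \<subseteq> points \<Delta>"
  shows "is_glb L j A \<longleftrightarrow> j \<in> points \<Delta> \<and> (\<forall>a\<in>A. (j, a) \<in> up\<^sup>*) \<and>
    (\<forall>u\<in>points \<Delta>. (\<forall>a\<in>A. (u, a) \<in> up\<^sup>*) \<longrightarrow> (u, j) \<in> up\<^sup>*)"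
  unfolding greatest_def Lower_def carrier_L le_L using assms by blast

lemma chart_is_lub:
  assumes S: "chart S \<rho>" and pqj: "p \<in> points S" "q \<in> points S" "j \<in> points S"
    and j: "pos \<rho> j = (\<lambda>i. max (pos \<rho> p i) (pos \<rho> q i))"
  shows "is_lub L j {p, q}" "p \<squnion>\<^bsub>L\<^esub> q = j"
proof -
  have "pos \<rho> p \<le> pos \<rho> j" "pos \<rho> q \<le> pos \<rho> j"
    by (simp_all add: j le_fun_def)
  then have "(p, j) \<in> up\<^sup>*" "(q, j) \<in> up\<^sup>*"
    using chart_le_up[OF S] pqj by auto
  then show *: "is_lub L j {p, q}"
    using chart_join[OF S pqj j] points_mono[OF S] pqj by (subst is_lub_iff) simp_all
  show "p \<squnion>\<^bsub>L\<^esub> q = j"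
    unfolding join_def sup_def using * by (metis L.least_unique someI_ex)
qed

lemma chart_is_glb:
  assumes S: "chart S \<rho>" and pqj: "p \<in> points S" "q \<in> points S" "j \<in> points S"
    and j: "pos \<rho> j = (\<lambda>i. min (pos \<rho> p i) (pos \<rho> q i))"
  shows "is_glb L j {p, q}" "p \<sqinter>\<^bsub>L\<^esub> q = j"
proof -
  have "pos \<rho> j \<le> pos \<rho> p" "pos \<rho> j \<le> pos \<rho> q"
    by (simp_all add: j le_fun_def)
  then have "(j, p) \<in> up\<^sup>*" "(j, q) \<in> up\<^sup>*"
    using chart_le_up[OF S] pqj by auto
  then show *: "is_glb L j {p, q}"
    using chart_meet[OF S pqj j] points_mono[OF S] pqj by (subst is_glb_iff) simp_all
  show "p \<sqinter>\<^bsub>L\<^esub> q = j"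
    unfolding meet_def inf_def using * by (metis L.greatest_unique someI_ex)
qed

lemma chart_join_meet_exist:
  assumes S: "chart S \<rho>" and p: "p \<in> points S" and q: "q \<in> points S"
  obtains j m where "j \<in> points S" "pos \<rho> j = (\<lambda>i. max (pos \<rho> p i) (pos \<rho> q i))"
    "m \<in> points S" "pos \<rho> m = (\<lambda>i. min (pos \<rho> p i) (pos \<rho> q i))"
proof -
  have Zn: "(\<lambda>i. max (pos \<rho> p i) (pos \<rho> q i)) \<in> Zn n" "(\<lambda>i. min (pos \<rho> p i) (pos \<rho> q i)) \<in> Zn n"
    using pos_Zn[OF S p] pos_Zn[OF S q] by (auto simp: Zn_def)
  obtain j where j: "j \<in> points S" "pos \<rho> j = (\<lambda>i. max (pos \<rho> p i) (pos \<rho> q i))"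
    using pos_surj[OF S Zn(1)] .
  obtain m where m: "m \<in> points S" "pos \<rho> m = (\<lambda>i. min (pos \<rho> p i) (pos \<rho> q i))"
    using pos_surj[OF S Zn(2)] .
  show thesis
    by (rule that[OF j m])
qed

sublocale L: lattice L
proof unfold_locales
  fix p q
  assume "p \<in> carrier L" "q \<in> carrier L"
  then have pq: "p \<in> points \<Delta>" "q \<in> points \<Delta>"
    by (simp_all add: carrier_L)
  obtain S \<rho> where S: "chart S \<rho>" and p: "p \<in> points S" and q: "q \<in> points S"
    using common_chart[OF pq] .
  obtain j m where jm: "j \<in> points S" "pos \<rho> j = (\<lambda>i. max (pos \<rho> p i) (pos \<rho> q i))"
    "m \<in> points S" "pos \<rho> m = (\<lambda>i. min (pos \<rho> p i) (pos \<rho> q i))"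
    using chart_join_meet_exist[OF S p q] .
  show "\<exists>s. is_lub L s {p, q}"
    using chart_is_lub(1)[OF S p q jm(1,2)] by blast
  show "\<exists>s. is_glb L s {p, q}"
    using chart_is_glb(1)[OF S p q jm(3,4)] by blast
qed

text \<open>Over a common apartment this is \<open>max a b + min a b = a + b\<close>, summed over the coordinates.\<close>

lemma rank_valuation:
  assumes "p \<in> carrier L" "q \<in> carrier L"
  shows "rank (p \<squnion>\<^bsub>L\<^esub> q) + rank (p \<sqinter>\<^bsub>L\<^esub> q) = rank p + rank q"
proof -
  obtain S \<rho> where S: "chart S \<rho>" and p: "p \<in> points S" and q: "q \<in> points S"
    using common_chart[OF assms[unfolded carrier_L]] .
  obtain j m where jm: "j \<in> points S" "pos \<rho> j = (\<lambda>i. max (pos \<rho> p i) (pos \<rho> q i))"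
    "m \<in> points S" "pos \<rho> m = (\<lambda>i. min (pos \<rho> p i) (pos \<rho> q i))"
    using chart_join_meet_exist[OF S p q] .
  have "rank j + rank m = height n (pos \<rho> j) + height n (pos \<rho> m)"
    using pos_height[OF S jm(1)] pos_height[OF S jm(3)] by simp
  also have "\<dots> = (\<Sum>i=1..n. max (pos \<rho> p i) (pos \<rho> q i) + min (pos \<rho> p i) (pos \<rho> q i))"
    by (simp add: jm height_def sum.distrib)
  also have "\<dots> = (\<Sum>i=1..n. pos \<rho> p i + pos \<rho> q i)"
    by (intro sum.cong) auto
  also have "\<dots> = height n (pos \<rho> p) + height n (pos \<rho> q)"
    by (simp add: height_def sum.distrib)
  also have "\<dots> = rank p + rank q"
    using pos_height[OF S] p q by simp
  finally show ?thesis
    using chart_is_lub(2)[OF S p q jm(1,2)] chart_is_glb(2)[OF S p q jm(3,4)] by simp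
qed

lemma finite_rank: "intervals_finite_rank L"
  unfolding intervals_finite_rank_def
proof (intro ballI impI)
  fix x y
  assume "x \<in> carrier L" "y \<in> carrier L" "x \<sqsubseteq>\<^bsub>L\<^esub> y"
  have "finite C \<and> card C \<le> nat (rank y - rank x) + 1"
    if C: "C \<subseteq> \<lbrace>x..y\<rbrace>\<^bsub>L\<^esub>" "Complete_Partial_Order.chain (le L) C" for C
  proof -
    have sub: "rank ` C \<subseteq> {rank x..rank y}"
    proof (rule image_subsetI)
      fix p
      assume "p \<in> C"
      then have "(x, p) \<in> up\<^sup>*" "(p, y) \<in> up\<^sup>*"
        using C(1) unfolding at_least_at_most_def le_L by blast+
      then show "rank p \<in> {rank x..rank y}"
        using rank_mono by simp
    qed
    have "inj_on rank C"
    proof (rule inj_onI)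
      fix p q
      assume "p \<in> C" "q \<in> C" "rank p = rank q"
      then show "p = q"
        using C(2) rank_eq[of p q] rank_eq[of q p] by (auto simp: chain_def le_L)
    qed
    then have "finite C" "card C = card (rank ` C)"
      using sub finite_subset[OF sub] by (auto simp: finite_image_iff card_image)
    moreover have "card (rank ` C) \<le> card {rank x..rank y}"
      using sub by (intro card_mono) auto
    ultimately show ?thesis
      by auto
  qed
  then show "\<exists>r. \<forall>C. C \<subseteq> \<lbrace>x..y\<rbrace>\<^bsub>L\<^esub> \<and> Complete_Partial_Order.chain (le L) C \<longrightarrow>
      finite C \<and> card C \<le> r + 1"
    by blast
qed

lemma modular: "modular_lattice L"
  unfolding modular_lattice_def
  using L.lattice_axioms finite_rank L.strict_valuation_modular[of rank] rank_valuation rank_eq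
  by (auto simp: le_L)

section \<open>The ascending operator\<close>

definition lift :: "'v \<times> int \<Rightarrow> 'v \<times> int" where
  "lift p = (fst p, snd p + 1)"

lemma lift_points: "lift p \<in> points S \<longleftrightarrow> p \<in> points S"
  by (simp add: points_iff lift_def)

lemma pos_lift: "pos \<rho> (lift p) = shift n 1 (pos \<rho> p)"
  by (simp add: lift_def pos_shift)

lemma covers_iff:
  assumes "p \<in> carrier L"
  shows "covers L q p \<longleftrightarrow> (p, q) \<in> up"
proof
  assume c: "covers L q p"
  then have "(p, q) \<in> up\<^sup>*" "p \<noteq> q"
    by (auto simp: covers_def lless_L)
  then obtain r where r: "(p, r) \<in> up" "(r, q) \<in> up\<^sup>*"
    by (metis converse_rtranclE)
  then have "r \<in> \<lbrace>p..q\<rbrace>\<^bsub>L\<^esub>"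
    using up_points by (auto simp: at_least_at_most_def le_L carrier_L)
  then have "r = p \<or> r = q"
    using c by (auto simp: covers_def)
  then show "(p, q) \<in> up"
    using r by (auto simp: up_iff)
next
  assume up: "(p, q) \<in> up"
  have "r = p \<or> r = q" if "(p, r) \<in> up\<^sup>*" "(r, q) \<in> up\<^sup>*" for r
  proof -
    have "rank r \<le> rank p \<or> rank q \<le> rank r"
      using up by (auto simp: up_iff)
    then show ?thesis
      using rank_eq that by blast
  qed
  moreover have "p \<noteq> q"
    using up by (auto simp: up_iff)
  ultimately show "covers L q p"
    using up up_points[OF up] by (auto simp: covers_def lless_L at_least_at_most_def carrier_L le_L)
qed

text \<open>In an apartment through \<open>p\<close> and an upper bound \<open>u\<close>, all the steps \<open>p + e\<^sub>i\<close> are below \<open>u\<close>, so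
\<open>p + \<one>\<close> is below \<open>u\<close>.\<close>

lemma asc_is_lub:
  assumes "p \<in> carrier L"
  shows "is_lub L (lift p) {q. covers L q p}"
proof -
  have p: "p \<in> points \<Delta>"
    using assms by (simp add: carrier_L)
  have upper: "(q, lift p) \<in> up\<^sup>*" if q: "(p, q) \<in> up" for q
  proof -
    obtain S \<rho> where S: "chart S \<rho>" "p \<in> points S" "q \<in> points S"
      using common_chart[of p q] up_points[OF q] by blast
    then have "pos \<rho> p \<le> pos \<rho> q" "height n (pos \<rho> q) = height n (pos \<rho> p) + 1"
      using q by (auto simp: chart_up_iff pos_height)
    then obtain i where "i \<in> {1..n}" "pos \<rho> q = (pos \<rho> p)(i := pos \<rho> p i + 1)"
      using Zn_cover pos_Zn[OF S(1)] S by metis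
    then have "pos \<rho> q \<le> pos \<rho> (lift p)"
      by (auto simp: pos_lift shift_def ones_def le_fun_def)
    then show ?thesis
      using chart_le_up S lift_points by metis
  qed
  have least: "(lift p, u) \<in> up\<^sup>*"
    if u: "u \<in> points \<Delta>" "\<And>q. (p, q) \<in> up \<Longrightarrow> (q, u) \<in> up\<^sup>*" for u
  proof -
    obtain S \<rho> where S: "chart S \<rho>" "p \<in> points S" "u \<in> points S"
      using common_chart[OF p u(1)] .
    have step: "(pos \<rho> p)(i := pos \<rho> p i + 1) \<le> pos \<rho> u" if i: "i \<in> {1..n}" for i
    proof -
      obtain q where q: "q \<in> points S" "pos \<rho> q = (pos \<rho> p)(i := pos \<rho> p i + 1)"
        using pos_surj[OF S(1) upd_in_Zn[OF pos_Zn[OF S(1,2)] i]] by metis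
      have "height n (pos \<rho> q) = height n (pos \<rho> p) + 1"
        unfolding q(2) by (rule height_upd[OF i])
      then have "rank q = rank p + 1"
        using pos_height[OF S(1)] q(1) S(2) by simp
      moreover have "pos \<rho> p \<le> pos \<rho> q"
        by (simp add: q le_fun_def)
      ultimately have "(p, q) \<in> up"
        using chart_up_iff[OF S(1,2) q(1)] by simp
      then show ?thesis
        using u(2) chart_le_iff[OF S(1) q(1) S(3)] q(2) by simp
    qed
    have "pos \<rho> p i + ones n i \<le> pos \<rho> u i" for i
    proof (cases "i \<in> {1..n}")
      case True
      then show ?thesis
        using step[OF True] by (auto simp: ones_def le_fun_def dest: spec[of _ i])
    next
      case False
      then show ?thesis
        using pos_Zn[OF S(1,2)] pos_Zn[OF S(1,3)] by (simp add: ones_def Zn_def)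
    qed
    then have "pos \<rho> (lift p) \<le> pos \<rho> u"
      by (simp add: pos_lift shift_def le_fun_def)
    then show ?thesis
      using chart_le_up S lift_points by metis
  qed
  have covers: "{q. covers L q p} = {q. (p, q) \<in> up}"
    by (simp add: covers_iff[OF assms])
  have sub: "{q. (p, q) \<in> up} \<subseteq> points \<Delta>"
    using up_points by blast
  show ?thesis
    unfolding covers is_lub_iff[OF sub] lift_points using p upper least by blast
qed

lemma asc_eq: "p \<in> carrier L \<Longrightarrow> asc L p = lift p"
  unfolding asc_def sup_def using asc_is_lub by (metis L.least_unique someI_ex)

lemma asc_automorphism: "lattice_automorphism L (asc L)"
proof -
  have closed: "p \<squnion>\<^bsub>L\<^esub> q \<in> carrier L" "p \<sqinter>\<^bsub>L\<^esub> q \<in> carrier L"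
    if "p \<in> carrier L" "q \<in> carrier L" for p q
    using that by simp_all
  have "bij_betw lift (carrier L) (carrier L)"
    by (rule bij_betw_byWitness[where f' = "\<lambda>p. (fst p, snd p - 1)"])
      (auto simp: lift_def carrier_L points_iff)
  then have bij: "bij_betw (asc L) (carrier L) (carrier L)"
    by (simp cong: bij_betw_cong add: asc_eq)
  have "lift (p \<squnion>\<^bsub>L\<^esub> q) = lift p \<squnion>\<^bsub>L\<^esub> lift q \<and> lift (p \<sqinter>\<^bsub>L\<^esub> q) = lift p \<sqinter>\<^bsub>L\<^esub> lift q"
    if "p \<in> carrier L" "q \<in> carrier L" for p q
  proof -
    have pq: "p \<in> points \<Delta>" "q \<in> points \<Delta>"
      using that by (simp_all add: carrier_L)
    obtain S \<rho> where S: "chart S \<rho>" and p: "p \<in> points S" and q: "q \<in> points S"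
      using common_chart[OF pq] .
    obtain j m where jm: "j \<in> points S" "pos \<rho> j = (\<lambda>i. max (pos \<rho> p i) (pos \<rho> q i))"
      "m \<in> points S" "pos \<rho> m = (\<lambda>i. min (pos \<rho> p i) (pos \<rho> q i))"
      using chart_join_meet_exist[OF S p q] .
    have lifted: "lift p \<in> points S" "lift q \<in> points S" "lift j \<in> points S" "lift m \<in> points S"
      using p q jm by (simp_all add: lift_points)
    have "pos \<rho> (lift j) = (\<lambda>i. max (pos \<rho> (lift p) i) (pos \<rho> (lift q) i))"
      "pos \<rho> (lift m) = (\<lambda>i. min (pos \<rho> (lift p) i) (pos \<rho> (lift q) i))"
      by (auto simp: pos_lift jm shift_def)
    then have "lift p \<squnion>\<^bsub>L\<^esub> lift q = lift j" "lift p \<sqinter>\<^bsub>L\<^esub> lift q = lift m"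
      using chart_is_lub(2)[OF S] chart_is_glb(2)[OF S] lifted by blast+
    then show ?thesis
      using chart_is_lub(2)[OF S p q jm(1,2)] chart_is_glb(2)[OF S p q jm(3,4)] by simp
  qed
  then show ?thesis
    using bij closed L.lattice_axioms
    by (simp add: lattice_automorphism_def join_pres_def meet_pres_def asc_eq)
qed

lemma uniform: "uniform_modular_lattice L"
  using modular asc_is_lub asc_automorphism unfolding uniform_modular_lattice_def by blast

section \<open>Recovering the building\<close>

lemma asc_pow_eq:
  assumes "p \<in> carrier L"
  shows "asc_pow L k p = (fst p, snd p + k)"
proof -
  have closed: "(fst p, k) \<in> carrier L" for k
    using assms by (simp add: carrier_L points_iff)
  have up: "(asc L ^^ m) p = (fst p, snd p + int m)" for m
    by (induction m) (use assms closed in \<open>auto simp: asc_eq lift_def\<close>)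
  have inj: "inj_on (asc L) (carrier L)"
    using asc_automorphism by (simp add: lattice_automorphism_def bij_betw_def)
  have inv: "inv_into (carrier L) (asc L) (fst p, k) = (fst p, k - 1)" for k
    by (rule inv_into_f_eq[OF inj closed]) (simp add: asc_eq closed lift_def)
  have down: "(inv_into (carrier L) (asc L) ^^ m) p = (fst p, snd p - int m)" for m
    by (induction m) (simp_all add: inv)
  show ?thesis
    by (simp add: asc_pow_def up down)
qed

lemma asc_class:
  assumes "p \<in> carrier L"
  shows "asc_equiv L `` {p} = {fst p} \<times> UNIV"
proof -
  have "(p, q) \<in> asc_equiv L \<longleftrightarrow> fst q = fst p" for q
  proof
    assume "fst q = fst p"
    then have "q \<in> carrier L" "asc_pow L (snd q - snd p) p = q"
      using assms by (auto simp: carrier_L points_iff asc_pow_eq prod_eq_iff)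
    then show "(p, q) \<in> asc_equiv L"
      using assms by (auto simp: asc_equiv_def)
  qed (auto simp: asc_equiv_def asc_pow_eq)
  then show ?thesis
    by (auto simp: prod_eq_iff)
qed

lemma classes: "bij_betw (\<lambda>x. {x} \<times> (UNIV :: int set)) (vertices \<Delta>) (carrier L // asc_equiv L)"
proof -
  have "carrier L // asc_equiv L = (\<lambda>p. {fst p} \<times> UNIV) ` carrier L"
    using asc_class by (auto simp: quotient_def)
  also have "\<dots> = (\<lambda>x. {x} \<times> UNIV) ` fst ` carrier L"
    by (simp add: image_image)
  also have "fst ` carrier L = vertices \<Delta>"
    by (auto simp: carrier_L points_def)
  finally show ?thesis
    by (auto simp: bij_betw_def inj_on_def)
qed

text \<open>The building inherits the flag property of its apartments along chains: once the vertices of a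
part of the chain are known to form a simplex, an apartment contains this simplex and the next
vertex, and there the simplices are determined by pairs.\<close>

lemma close_chain_simplex:
  assumes "finite P" "P \<subseteq> points \<Delta>"
    and "\<And>p q. p \<in> P \<Longrightarrow> q \<in> P \<Longrightarrow>
      (p, q) \<in> up\<^sup>* \<and> (q, lift p) \<in> up\<^sup>* \<or> (q, p) \<in> up\<^sup>* \<and> (p, lift q) \<in> up\<^sup>*"
  shows "fst ` P \<in> \<Delta>"
  using assms
proof (induction rule: finite_induct)
  case empty
  have "vertices \<Delta> \<noteq> {}"
    using building_complex by (simp add: simplicial_complex_on_def)
  then show ?case
    using simplex_subset[OF simplex_singleton] by auto
next
  case (insert p P)
  then have "fst ` P \<in> \<Delta>" "{fst p} \<in> \<Delta>"
    using simplex_singleton by (auto simp: points_iff)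
  then obtain S where S: "S \<in> \<A>" "fst ` P \<in> S" "{fst p} \<in> S"
    using common_apartment by metis
  obtain \<rho> where \<rho>: "chart S \<rho>"
    using chart_exists[OF S(1)] .
  have sub: "insert p P \<subseteq> points S"
    using simplex_vertices[OF S(2)] simplex_vertices[OF S(3)] by (auto simp: points_iff)
  have near: "near n (pos \<rho> u) (pos \<rho> v)"
    if "(u, v) \<in> up\<^sup>*" "(v, lift u) \<in> up\<^sup>*" "u \<in> points S" "v \<in> points S" for u v
    using that chart_le_iff[OF \<rho>] lift_points by (simp add: near_def pos_lift [symmetric])
  have "fst ` insert p P \<in> S"
  proof (rule near_simplex[OF \<rho> sub])
    show "finite (insert p P)"
      using insert.hyps by simp
    fix u v
    assume uv: "u \<in> insert p P" "v \<in> insert p P"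
    then have "u \<in> points S" "v \<in> points S"
      using sub by auto
    then show "near n (pos \<rho> u) (pos \<rho> v) \<or> near n (pos \<rho> v) (pos \<rho> u)"
      using insert.prems(2)[OF uv] near by blast
  qed
  then show ?case
    by (rule apartment_subset[OF S(1)])
qed

lemma short_chain_simplex:
  assumes "short_chain L xs"
  shows "fst ` set xs \<in> \<Delta>"
proof (cases "xs = []")
  case True
  then show ?thesis
    using close_chain_simplex[of "{}"] by simp
next
  case False
  have sub: "set xs \<subseteq> points \<Delta>" and sorted: "sorted_wrt (lless L) xs"
    and last: "(last xs, asc L (hd xs)) \<in> up\<^sup>*"
    using assms False by (auto simp: short_chain_def carrier_L le_L)
  have hd: "hd xs \<in> points \<Delta>"
    using sub False by auto
  have close: "(q, lift p) \<in> up\<^sup>*" if pq: "p \<in> set xs" "q \<in> set xs" for p q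
  proof -
    have "(hd xs, p) \<in> up\<^sup>*"
      using sorted_wrt_between(1)[OF sorted pq(1)] by (auto simp: lless_L)
    moreover obtain S \<rho> where S: "chart S \<rho>" "hd xs \<in> points S" "p \<in> points S"
      using common_chart[OF hd subsetD[OF sub pq(1)]] .
    ultimately have "(lift (hd xs), lift p) \<in> up\<^sup>*"
      using chart_le_iff[OF S(1)] by (simp add: lift_points pos_lift shift_le_shift)
    moreover have "(q, last xs) \<in> up\<^sup>*"
      using sorted_wrt_between(2)[OF sorted pq(2)] by (auto simp: lless_L)
    moreover have "(last xs, lift (hd xs)) \<in> up\<^sup>*"
      using last asc_eq hd by (simp add: carrier_L)
    ultimately show ?thesis
      by (meson rtrancl_trans)
  qed
  show ?thesis
  proof (rule close_chain_simplex[OF _ sub])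
    fix p q
    assume pq: "p \<in> set xs" "q \<in> set xs"
    then have "(p, q) \<in> up\<^sup>* \<or> (q, p) \<in> up\<^sup>*"
      using sorted_wrt_comparable[OF sorted pq] by (auto simp: lless_L)
    then show "(p, q) \<in> up\<^sup>* \<and> (q, lift p) \<in> up\<^sup>* \<or> (q, p) \<in> up\<^sup>* \<and> (p, lift q) \<in> up\<^sup>*"
      using close pq by blast
  qed simp
qed

text \<open>In an apartment containing \<open>A\<close> the chain of \<open>O_Lambda n\<close> that represents \<open>A\<close> is lifted with
second component \<open>0\<close> throughout.\<close>

lemma simplex_short_chain:
  assumes "A \<in> \<Delta>"
  obtains xs where "short_chain L xs" "fst ` set xs = A"
proof -
  obtain S where S: "S \<in> \<A>" "A \<in> S"
    using common_apartment[OF assms assms] .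
  obtain \<rho> where \<rho>: "chart S \<rho>"
    using chart_exists[OF S(1)] .
  note sub = simplex_vertices[OF S(2)]
  have "\<rho> ` A \<in> O_Lambda n"
    using \<rho> S(2) sub by (simp add: chart_def complex_iso_def)
  then obtain zs where zs: "\<rho> ` A = set zs" "sorted_wrt (<) zs"
      "zs \<noteq> [] \<longrightarrow> last zs < (\<lambda>i. hd zs i + ones n i)"
    by (auto simp: O_Lambda_def)
  define g where "g = (\<lambda>z. (inv_into A \<rho> z, 0 :: int))"
  have g: "g z \<in> points S" "pos \<rho> (g z) = z" if "z \<in> set zs" for z
  proof -
    have z: "z \<in> \<rho> ` A"
      using that zs(1) by simp
    show "g z \<in> points S"
      using inv_into_into[OF z] sub by (auto simp: g_def points_iff)
    show "pos \<rho> (g z) = z"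
      using f_inv_into_f[OF z] by (simp add: g_def pos_def)
  qed
  have less: "lless L (g z) (g w)" if "z \<in> set zs" "w \<in> set zs" "z < w" for z w
  proof -
    have "(g z, g w) \<in> up\<^sup>*"
      using g(2)[OF that(1)] g(2)[OF that(2)] that(3)
      by (intro chart_le_up[OF \<rho> g(1)[OF that(1)] g(1)[OF that(2)]]) simp
    moreover have "g z \<noteq> g w"
      using g(2)[OF that(1)] g(2)[OF that(2)] that(3) by (metis less_irrefl)
    ultimately show ?thesis
      by (simp add: lless_L)
  qed
  have "sorted_wrt (\<lambda>z w. lless L (g z) (g w)) zs"
    by (rule sorted_wrt_mono_rel[OF _ zs(2)]) (rule less)
  then have "sorted_wrt (lless L) (map g zs)"
    by (simp add: sorted_wrt_map)
  moreover have "last (map g zs) \<sqsubseteq>\<^bsub>L\<^esub> asc L (hd (map g zs))" if "zs \<noteq> []"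
  proof -
    have mem: "last zs \<in> set zs" "hd zs \<in> set zs"
      using that by simp_all
    have "pos \<rho> (g (last zs)) \<le> pos \<rho> (lift (g (hd zs)))"
      using zs(3) that by (simp add: g mem pos_lift shift_def less_imp_le)
    then have "(g (last zs), lift (g (hd zs))) \<in> up\<^sup>*"
      using chart_le_up[OF \<rho>] g(1) mem by (simp add: lift_points)
    then show ?thesis
      using that g(1)[OF mem(2)] points_mono[OF \<rho>]
      by (simp add: asc_eq carrier_L le_L last_map hd_map)
  qed
  moreover have "set (map g zs) \<subseteq> carrier L"
    unfolding carrier_L set_map using g(1) points_mono[OF \<rho>] by blast
  ultimately have "short_chain L (map g zs)"
    by (simp add: short_chain_def)
  moreover have "fst ` set (map g zs) = A"
  proof -
    have "inj_on \<rho> A"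
      using chart_bij[OF \<rho>] sub by (meson bij_betw_def inj_on_subset)
    then have "inv_into A \<rho> ` \<rho> ` A = A"
      by (simp add: image_image)
    then show ?thesis
      by (simp add: image_image g_def zs(1) [symmetric])
  qed
  ultimately show thesis
    using that by blast
qed

lemma complex_eq:
  "(\<lambda>A. (\<lambda>x. {x} \<times> (UNIV :: int set)) ` A) ` \<Delta> = lattice_complex L"
proof -
  have image_class: "(\<lambda>p. asc_equiv L `` {p}) ` set xs = (\<lambda>x. {x} \<times> UNIV) ` fst ` set xs"
    if "short_chain L xs" for xs
    unfolding image_image
  proof (rule image_cong)
    fix p
    assume "p \<in> set xs"
    then show "asc_equiv L `` {p} = {fst p} \<times> UNIV"
      using that asc_class[of p] by (auto simp: short_chain_def)
  qed simp
  show ?thesis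
  proof (intro equalityI subsetI)
    fix X
    assume "X \<in> (\<lambda>A. (\<lambda>x. {x} \<times> (UNIV :: int set)) ` A) ` \<Delta>"
    then obtain A where A: "A \<in> \<Delta>" "X = (\<lambda>x. {x} \<times> UNIV) ` A"
      by blast
    then obtain xs where "short_chain L xs" "fst ` set xs = A"
      using simplex_short_chain by metis
    then show "X \<in> lattice_complex L"
      using image_class A(2) unfolding lattice_complex_def by blast
  next
    fix X
    assume "X \<in> lattice_complex L"
    then obtain xs where "short_chain L xs" "X = (\<lambda>p. asc_equiv L `` {p}) ` set xs"
      unfolding lattice_complex_def by blast
    then show "X \<in> (\<lambda>A. (\<lambda>x. {x} \<times> (UNIV :: int set)) ` A) ` \<Delta>"
      using image_class short_chain_simplex by blast
  qed
qed

end

theorem theorem3p16: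
  fixes n :: nat and \<Delta> :: "'v set set" and \<A> :: "'v set set set" and col :: "'v \<Rightarrow> nat"
  assumes "n \<ge> 1"
    and "affine_building n \<Delta> \<A>"
    and "natural_coloring n \<Delta> \<A> col"
  shows "uniform_modular_lattice (building_poset n \<Delta> col) \<and>
    bij_betw (\<lambda>x. {x} \<times> (UNIV :: int set)) (vertices \<Delta>)
      (carrier (building_poset n \<Delta> col) // asc_equiv (building_poset n \<Delta> col)) \<and>
    (\<lambda>A. (\<lambda>x. {x} \<times> (UNIV :: int set)) ` A) ` \<Delta> = lattice_complex (building_poset n \<Delta> col)"
proof -
  interpret colored_building n \<Delta> \<A> col
    by (rule colored_building.intro) (fact assms)+
  show ?thesis
    using uniform classes complex_eq by blast
qed

end
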